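(* Let $r\ge 1$, $k\ge 0$ and $s$ be integers, let $m=(2r-1)(k+1)$, and let $[m]=C_1\uplus\dots\uplus C_{k+1}$ be a coloring of the vertices of the simplex $\Delta_{[m]}$ with $|C_i|=2r-1$ for each $i$. Let $\mathcal{K}=\langle K_1,\dots,K_r\rangle$ be a collectively $(r,s)$-rainbow unavoidable family of subcomplexes of $\Delta_{[m]}$ such that each $K_i$ is $(m,k)$-rainbow balanced. Then the simplicial complex $SymmDelJoin(\mathcal{K})$ is $(rk+s-2)$-connected.
   Context: $[m]=\{1,\dots,m\}$ and $\Delta_{[m]}$ is identified with $2^{[m]}$. A coloring by $k+1$ colors is a partition $[m]=C_1\uplus\dots\uplus C_{k+1}$; a set $V$ is rainbow if $|V\cap C_i|\le1$ for all $i$; a complex is rainbow if all its simplices are. $Col\Delta_{[m]}^{(j)}$ is the complex of rainbow subsets of $[m]$ of size at most $j+1$. $K$ is $(m,k)$-rainbow balanced if $Col\Delta_{[m]}^{(k-1)}\subseteq K\subseteq Col\Delta_{[m]}^{(k)}$. A rainbow partition $(A_1,\dots,A_r,B)$ of $[m]$ is an ordered partition into pairwise disjoint (possibly empty) sets with all $A_i$ rainbow. $\langle K_1,\dots,K_r\rangle$ (rainbow complexes) is collectively $(r,s)$-rainbow unavoidable if for every ordered rainbow partition $(A_1,\dots,A_r,B)$ there are $s$ distinct indices $i_1,\dots,i_s$ with $A_{i_j}\in K_{i_j}$ for all $j$. For complexes $L_1,\dots,L_r\subseteq 2^{[m]}$, the deleted join $L_1*_\Delta\dots*_\Delta L_r$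 is the simplicial complex on vertex set the disjoint union of $r$ copies of $[m]$ whose simplices are $A_1\uplus\dots\uplus A_r$ ($A_i$ in the $i$-th copy) with $A_i\in L_i$ and $A_i\cap A_j=\emptyset$ for $i\ne j$. The symmetrized deleted join is $SymmDelJoin(\mathcal{K})=\bigcup_{\pi\in S_r}K_{\pi(1)}*_\Delta\dots*_\Delta K_{\pi(r)}$. A space is $n$-connected if it is nonempty and its homotopy groups $\pi_i$ vanish for $0\le i\le n$.
   Formalization: For n ≤ -2, being n-connected is taken to be no condition (nonemptiness is required only for n ≥ -1); otherwise the claim fails for k = s = 0 with every K_i = {∅}, where SymmDelJoin(K) is empty. *)

theory Defs
  imports "HOL-Homology.Homology" "HOL-Combinatorics.Permutations"
begin

section \<open>Homotopy groups and connectivity\<close>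

definition sphere_base :: "nat \<Rightarrow> real"
  where "sphere_base = (\<lambda>j. if j = 0 then 1 else 0)"

text \<open>The underlying set of \<open>\<pi>\<^sub>i(X, a)\<close>: pointed maps from the \<open>i\<close>-sphere
  to \<open>(X, a)\<close> modulo homotopies that keep the base point at \<open>a\<close>.\<close>

definition homotopy_group_set :: "nat \<Rightarrow> 'a topology \<Rightarrow> 'a \<Rightarrow> (((nat \<Rightarrow> real) \<Rightarrow> 'a) set) set"
  where "homotopy_group_set i X a =
    {f. continuous_map (nsphere i) X f \<and> f sphere_base = a} //
    {(f, g). homotopic_with (\<lambda>h. h sphere_base = a) (nsphere i) X f g}"

text \<open>A homotopy group (for \<open>i = 0\<close>, a pointed set) vanishes iff its underlying set is a
  singleton. As usual, \<open>(-1)\<close>-connected means nonempty, and for \<open>n \<le> -2\<close> every space,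
  including the empty one, is \<open>n\<close>-connected.\<close>

definition n_connected_space :: "int \<Rightarrow> 'a topology \<Rightarrow> bool"
  where "n_connected_space n X \<longleftrightarrow>
    (-1 \<le> n \<longrightarrow> topspace X \<noteq> {}) \<and>
    (\<forall>i::nat. int i \<le> n \<longrightarrow> (\<forall>a \<in> topspace X. is_singleton (homotopy_group_set i X a)))"

section \<open>Abstract simplicial complexes\<close>

text \<open>The empty simplex belongs to every complex; the constant name \<open>simplicial_complex\<close> of
  the library is reserved for geometric complexes in Euclidean space.\<close>

definition subcomplex_of_simplex :: "nat \<Rightarrow> nat set set \<Rightarrow> bool"
  where "subcomplex_of_simplex m K \<longleftrightarrow>
    K \<subseteq> Pow {1..m} \<and> {} \<in> K \<and> (\<forall>A\<in>K. \<forall>B. B \<subseteq> A \<longrightarrow> B \<in> K)"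

text \<open>Points are given by barycentric coordinates. The topology is that of pointwise convergence
  of the coordinates, which is the usual one for complexes with finitely many simplices.\<close>

definition geometric_realization :: "'v set set \<Rightarrow> ('v \<Rightarrow> real) topology"
  where "geometric_realization K =
    subtopology (powertop_real UNIV)
      {x. (\<forall>v. 0 \<le> x v) \<and> {v. x v \<noteq> 0} \<in> K \<and> (\<Sum>v | x v \<noteq> 0. x v) = 1}"

text \<open>The \<open>i\<close>-th copy of a vertex \<open>a\<close> is the pair \<open>(i, a)\<close>, so \<open>Sigma {1..r} A\<close> is
  the disjoint union of the sets \<open>A i\<close>.\<close>

definition deleted_join :: "nat \<Rightarrow> (nat \<Rightarrow> 'v set set) \<Rightarrow> (nat \<times> 'v) set set"
  where "deleted_join r L =
    {Sigma {1..r} A | A. (\<forall>i\<in>{1..r}. A i \<in> L i) \<and> disjoint_family_on A {1..r}}"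

definition symm_deleted_join :: "nat \<Rightarrow> (nat \<Rightarrow> 'v set set) \<Rightarrow> (nat \<times> 'v) set set"
  where "symm_deleted_join r K =
    (\<Union>\<pi>\<in>{\<pi>. \<pi> permutes {1..r}}. deleted_join r (\<lambda>i. K (\<pi> i)))"

section \<open>Colorings and rainbow complexes\<close>

definition coloring :: "nat \<Rightarrow> nat \<Rightarrow> (nat \<Rightarrow> nat set) \<Rightarrow> bool"
  where "coloring m k C \<longleftrightarrow>
    (\<Union>i\<in>{1..k+1}. C i) = {1..m} \<and> disjoint_family_on C {1..k+1}"

definition rainbow :: "nat \<Rightarrow> (nat \<Rightarrow> nat set) \<Rightarrow> nat set \<Rightarrow> bool"
  where "rainbow k C V \<longleftrightarrow> (\<forall>i\<in>{1..k+1}. card (V \<inter> C i) \<le> 1)"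

text \<open>The dimension \<open>j\<close> is an integer because \<open>j = -1\<close> occurs below.\<close>

definition rainbow_skeleton :: "nat \<Rightarrow> nat \<Rightarrow> (nat \<Rightarrow> nat set) \<Rightarrow> int \<Rightarrow> nat set set"
  where "rainbow_skeleton m k C j =
    {V. V \<subseteq> {1..m} \<and> rainbow k C V \<and> int (card V) \<le> j + 1}"

definition rainbow_balanced :: "nat \<Rightarrow> nat \<Rightarrow> (nat \<Rightarrow> nat set) \<Rightarrow> nat set set \<Rightarrow> bool"
  where "rainbow_balanced m k C K \<longleftrightarrow>
    rainbow_skeleton m k C (int k - 1) \<subseteq> K \<and> K \<subseteq> rainbow_skeleton m k C (int k)"

definition rainbow_partition ::
    "nat \<Rightarrow> nat \<Rightarrow> (nat \<Rightarrow> nat set) \<Rightarrow> nat \<Rightarrow> (nat \<Rightarrow> nat set) \<Rightarrow> nat set \<Rightarrow> bool"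
  where "rainbow_partition m k C r A B \<longleftrightarrow>
    (\<Union>i\<in>{1..r}. A i) \<union> B = {1..m} \<and>
    disjoint_family_on A {1..r} \<and> (\<forall>i\<in>{1..r}. A i \<inter> B = {}) \<and>
    (\<forall>i\<in>{1..r}. rainbow k C (A i))"

definition collectively_rainbow_unavoidable ::
    "nat \<Rightarrow> nat \<Rightarrow> (nat \<Rightarrow> nat set) \<Rightarrow> nat \<Rightarrow> int \<Rightarrow> (nat \<Rightarrow> nat set set) \<Rightarrow> bool"
  where "collectively_rainbow_unavoidable m k C r s K \<longleftrightarrow>
    (\<forall>A B. rainbow_partition m k C r A B \<longrightarrow>
      (\<exists>idx :: int \<Rightarrow> nat. inj_on idx {1..s} \<and>
        (\<forall>j\<in>{1..s}. idx j \<in> {1..r} \<and> A (idx j) \<in> K (idx j))))"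

end

(* The simplices are tuples of disjoint rainbow sets, one per row, whose full rows (those of size
   k + 1) can be matched with members of the family that contain them. One removes vertices one by
   one: if the deletion of a vertex is n-connected and its link is (n - 1)-connected, then the
   complex is n-connected. Since each color class has 2r - 1 elements, there is room to delete
   vertices until each open color of each row has one vertex left, which no other row uses. A row with two
   open colors then contributes a cone after one deletion. In a row with one open color, either the
   last vertex is a cone point, or the row can be abandoned: by exchanging it with the rows abandoned
   before, one sees that its full set is missing in more members of the family than there are
   abandoned rows. So the sets of the abandoned rows are distinctly matched to members not containing
   them, and unavoidability leaves at most r - s of these rows; then every simplex that
   survives has at least rk + s vertices.

   n-connectedness is treated as an extension property for maps on the boundaries of cubes. The
   union of two open sets is handled by subdividing the boundary into a fine cubical grid. *)
theory Submission
  imports Defs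
begin

section \<open>Extension of maps from boundaries of cubes\<close>

text \<open>The bound proved for the link of a simplex \<open>\<sigma>\<close> on the remaining
  vertices is \<open>rk + s - 2 - |\<sigma>|\<close>. A link enters the gluing step with one degree
  less, and its \<open>\<sigma>\<close> has one vertex more, so the induction is exact; deletions
  leave the bound alone.

  The obstacle is that membership of sets of size \<open>k + 1\<close> in the \<open>K i\<close> is
  arbitrary, while all smaller rainbow sets lie in every \<open>K i\<close>. Hence a row accepts a
  vertex of one open color once another color can no longer occur in it. Moreover, a row stuck at
  \<open>k\<close> elements fits every member of the family, so it can give its own member away;
  this drives the exchange argument.

  The number \<open>2r - 1\<close> is one vertex to keep plus two for each of the
  \<open>r - 1\<close> other rows. A row that occupies a color can cost another row two vertices of
  that color: the one it uses, and the one that had been withdrawn from the other rows in its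
  favour. After that it makes no further claim on this color.

  Extending maps over cubes treats all dimensions alike: the gluing of two open sets covers
  nonemptiness, path connectedness and the higher groups in one argument.\<close>

definition cube :: "nat set \<Rightarrow> (nat \<Rightarrow> real) set"
  where "cube J = {x. (\<forall>j\<in>J. \<bar>x j\<bar> \<le> 1) \<and> (\<forall>j. j \<notin> J \<longrightarrow> x j = 0)}"

definition cube_boundary :: "nat set \<Rightarrow> (nat \<Rightarrow> real) set"
  where "cube_boundary J = {x \<in> cube J. \<exists>j\<in>J. \<bar>x j\<bar> = 1}"

text \<open>The boundary of a cube on \<open>card J\<close> coordinates is a sphere of dimension
  \<open>card J - 1\<close>, which explains the bound \<open>n + 1\<close>. For
  \<open>J = {}\<close> the boundary is empty and a point of \<open>X\<close> is demanded. Arbitrary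
  finite \<open>J\<close> instead of initial segments let the free directions of a grid cell serve
  as they are.\<close>

definition cube_connected :: "int \<Rightarrow> 'a::topological_space set \<Rightarrow> bool"
  where "cube_connected n X \<longleftrightarrow>
    (\<forall>J f. finite J \<longrightarrow> int (card J) \<le> n + 1 \<longrightarrow> continuous_on (cube_boundary J) f \<longrightarrow>
      f ` cube_boundary J \<subseteq> X \<longrightarrow>
      (\<exists>F. continuous_on (cube J) F \<and> F ` cube J \<subseteq> X \<and> (\<forall>x\<in>cube_boundary J. F x = f x)))"

lemma cube_connectedD:
  assumes "cube_connected n X" "finite J" "int (card J) \<le> n + 1"
    "continuous_on (cube_boundary J) f" "f ` cube_boundary J \<subseteq> X"
  obtains F where "continuous_on (cube J) F" "F ` cube J \<subseteq> X"
    "\<And>x. x \<in> cube_boundary J \<Longrightarrow> F x = f x"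
  using assms unfolding cube_connected_def by metis

lemma cube_connected_trivial: "n \<le> -2 \<Longrightarrow> cube_connected n X"
  unfolding cube_connected_def by auto

lemma continuous_on_coord [continuous_intros]:
  "continuous_on S (\<lambda>x::'a \<Rightarrow> 'b::topological_space. x i)"
  by (rule continuous_on_product_then_coordinatewise) (rule continuous_on_id)

lemma closed_cube: "closed (cube J)"
proof -
  have "cube J = (\<Inter>j\<in>J. {x. \<bar>x j\<bar> \<le> 1}) \<inter> (\<Inter>j\<in>-J. {x. x j = 0})"
    by (auto simp: cube_def)
  moreover have "closed {x::nat\<Rightarrow>real. \<bar>x j\<bar> \<le> 1}" for j
    by (intro closed_Collect_le continuous_intros)
  moreover have "closed {x::nat\<Rightarrow>real. x j = 0}" for j
    by (intro closed_Collect_eq continuous_intros)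
  ultimately show ?thesis by (simp only:) (intro closed_Int closed_INT ballI)
qed

lemma compact_cube: "compact (cube J)"
proof -
  have "cube J = PiE UNIV (\<lambda>j. if j \<in> J then {-1..1::real} else {0})"
    by (force simp: cube_def PiE_def Pi_def abs_le_iff)
  moreover have "compactin (product_topology (\<lambda>j::nat. euclideanreal) UNIV) (PiE UNIV (\<lambda>j. if j \<in> J then {-1..1::real} else {0}))"
    by (subst compactin_PiE) auto
  ultimately show ?thesis
    by (simp add: euclidean_product_topology)
qed

lemma compact_cube_boundary: 
  assumes "finite J"
  shows "compact (cube_boundary J)"
proof -
  have "cube_boundary J = cube J \<inter> (\<Union>j\<in>J. {x. \<bar>x j\<bar> = 1})"
    by (auto simp: cube_boundary_def)
  moreover have "closed {x::nat\<Rightarrow>real. \<bar>x j\<bar> = 1}" for j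
    by (intro closed_Collect_eq continuous_intros)
  ultimately show ?thesis
    using assms by (simp add: compact_Int_closed[OF compact_cube] closed_UN)
qed

text \<open>The sup norm of the coordinates in \<open>J\<close>; the inserted 0 makes it 0 for
  \<open>J = {}\<close>.\<close>

definition cube_gauge :: "nat set \<Rightarrow> (nat \<Rightarrow> real) \<Rightarrow> real"
  where "cube_gauge J x = Max (insert 0 ((\<lambda>j. \<bar>x j\<bar>) ` J))"

lemma continuous_on_cube_gauge:
  assumes "finite J"
  shows "continuous_on S (cube_gauge J)"
  using assms
proof (induction J)
  case empty
  then show ?case by (simp add: cube_gauge_def)
next
  case (insert j J)
  have "cube_gauge (insert j J) = (\<lambda>x. max \<bar>x j\<bar> (cube_gauge J x))"
  proof
    fix x :: "nat \<Rightarrow> real"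
    have "insert 0 ((\<lambda>j. \<bar>x j\<bar>) ` insert j J) = insert \<bar>x j\<bar> (insert 0 ((\<lambda>j. \<bar>x j\<bar>) ` J))"
      by auto
    then show "cube_gauge (insert j J) x = max \<bar>x j\<bar> (cube_gauge J x)"
      unfolding cube_gauge_def using insert(1) by (simp only: Max_insert finite_insert finite_imageI) simp
  qed
  moreover have "continuous_on S (\<lambda>x. max \<bar>x j\<bar> (cube_gauge J x))"
    using insert by (intro continuous_intros) auto
  ultimately show ?case by simp
qed

lemma cube_gauge_nonneg: "finite J \<Longrightarrow> 0 \<le> cube_gauge J x"
  by (simp add: cube_gauge_def)

lemma cube_gauge_ge: "finite J \<Longrightarrow> j \<in> J \<Longrightarrow> \<bar>x j\<bar> \<le> cube_gauge J x"
  by (simp add: cube_gauge_def)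

lemma cube_gauge_cases: 
  assumes "finite J" "cube_gauge J x \<noteq> 0"
  obtains j where "j \<in> J" "cube_gauge J x = \<bar>x j\<bar>"
proof -
  have "cube_gauge J x \<in> insert 0 ((\<lambda>j. \<bar>x j\<bar>) ` J)"
    unfolding cube_gauge_def using assms by (intro Max_in) auto
  then show ?thesis using assms that by auto
qed

lemma cube_gauge_le_1: "finite J \<Longrightarrow> x \<in> cube J \<Longrightarrow> cube_gauge J x \<le> 1"
  by (auto simp: cube_gauge_def cube_def)

lemma cube_gauge_boundary:
  assumes "finite J" "x \<in> cube_boundary J"
  shows "cube_gauge J x = 1"
proof -
  obtain j where "j \<in> J" "\<bar>x j\<bar> = 1" using assms by (auto simp: cube_boundary_def)
  then show ?thesis using cube_gauge_ge[of J j x] cube_gauge_le_1[of J x] assms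
    by (auto simp: cube_boundary_def)
qed

lemma scale_cube:
  assumes "finite J" "\<And>j. j \<notin> J \<Longrightarrow> x j = 0" "c * cube_gauge J x \<le> 1" "0 \<le> c"
  shows "(\<lambda>j. c * x j) \<in> cube J"
proof -
  have "\<bar>c * x j\<bar> \<le> 1" if "j \<in> J" for j
    using mult_left_mono[OF cube_gauge_ge[OF assms(1) that, of x] assms(4)] assms(3,4) 
    by (simp add: abs_mult)
  then show ?thesis using assms by (auto simp: cube_def)
qed

lemma scale_cube_boundary:
  assumes "finite J" "\<And>j. j \<notin> J \<Longrightarrow> x j = 0" "cube_gauge J x \<noteq> 0"
  shows "(\<lambda>j. x j / cube_gauge J x) \<in> cube_boundary J"
proof -
  have pos: "cube_gauge J x > 0" using cube_gauge_nonneg[OF assms(1), of x] assms(3) by simp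
  have "(\<lambda>j. (1 / cube_gauge J x) * x j) \<in> cube J"
    using assms pos by (intro scale_cube) auto
  moreover obtain j where "j \<in> J" "cube_gauge J x = \<bar>x j\<bar>"
    using cube_gauge_cases[OF assms(1,3)] by metis
  ultimately show ?thesis using pos by (auto simp: cube_boundary_def intro!: bexI[of _ j])
qed

text \<open>The homotopy is run through in the outer shell of the cube, and the extension that exists
  at the end of the homotopy is shrunk to the inner half.\<close>

lemma cube_extension_homotopy:
  fixes h :: "real \<times> (nat \<Rightarrow> real) \<Rightarrow> 'a::topological_space"
  assumes J: "finite J"
    and h: "continuous_on ({0..1} \<times> cube_boundary J) h" "h ` ({0..1} \<times> cube_boundary J) \<subseteq> X"
    and G: "continuous_on (cube J) G" "G ` cube J \<subseteq> X"
    and hG: "\<And>x. x \<in> cube_boundary J \<Longrightarrow> h (1, x) = G x"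
  obtains F where "continuous_on (cube J) F" "F ` cube J \<subseteq> X"
    "\<And>x. x \<in> cube_boundary J \<Longrightarrow> F x = h (0, x)"
proof -
  define g where "g = cube_gauge J"
  have cg [continuous_intros]: "continuous_on S g" for S
    unfolding g_def by (rule continuous_on_cube_gauge[OF J])
  define A where "A = {x \<in> cube J. g x \<le> 1/2}"
  define B where "B = {x \<in> cube J. 1/2 \<le> g x}"
  \<comment> \<open>On the shell, time runs from 1 at gauge 1/2, where the inner copy of
    \<open>G\<close> ends, to 0 on the boundary, while the point is projected radially to the
    boundary.\<close>
  define p where "p x = (2 - 2 * g x, \<lambda>j. x j / g x)" for x
  define F where "F x = (if g x \<le> 1/2 then G (\<lambda>j. 2 * x j) else h (p x))" for x
  have clA: "closed A" 
  proof -
    have "A = cube J \<inter> {x. g x \<le> 1/2}" by (auto simp: A_def)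
    moreover have "closed {x. g x \<le> 1/2}" by (intro closed_Collect_le continuous_intros)
    ultimately show ?thesis using closed_cube by auto
  qed
  have clB: "closed B" 
  proof -
    have "B = cube J \<inter> {x. 1/2 \<le> g x}" by (auto simp: B_def)
    moreover have "closed {x. 1/2 \<le> g x}" by (intro closed_Collect_le continuous_intros)
    ultimately show ?thesis using closed_cube by auto
  qed
  have AB: "cube J = A \<union> B" by (auto simp: A_def B_def)
  have imA: "(\<lambda>j. 2 * x j) \<in> cube J" if "x \<in> A" for x
    using that by (intro scale_cube J) (auto simp: A_def g_def cube_def)
  have imB: "p x \<in> {0..1} \<times> cube_boundary J" if "x \<in> B" for x
    using that scale_cube_boundary[OF J, of x] cube_gauge_le_1[OF J, of x]
    by (auto simp: B_def g_def cube_def p_def)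
  have cA: "continuous_on A (\<lambda>x. G (\<lambda>j. 2 * x j))"
    by (rule continuous_on_compose2[OF G(1)]) (use imA in \<open>auto intro!: continuous_intros\<close>)
  have cB: "continuous_on B (\<lambda>x. h (p x))"
  proof (rule continuous_on_compose2[OF h(1)])
    show "continuous_on B p" unfolding p_def
      by (intro continuous_intros) (auto simp: B_def)
  qed (use imB in blast)
  have "continuous_on (A \<union> B) F" unfolding F_def
  proof (rule continuous_on_If[OF _ _ cA cB])
    show "closed A" "closed B" by fact+
  next
    fix x assume "x \<in> A" "\<not> g x \<le> 1/2"
    then show "G (\<lambda>j. 2 * x j) = h (p x)" by (auto simp: A_def)
  next
    fix x assume x: "x \<in> B" "g x \<le> 1/2"
    then have "g x = 1/2" by (auto simp: B_def)
    then have "p x = (1, \<lambda>j. 2 * x j)" unfolding p_def by (simp only:) (simp add: mult.commute)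
    then show "G (\<lambda>j. 2 * x j) = h (p x)"
      using imB[OF x(1)] hG[of "\<lambda>j. 2 * x j"] by simp
  qed
  then have "continuous_on (cube J) F" by (simp add: AB)
  moreover have "F ` cube J \<subseteq> X"
  proof safe
    fix x assume x: "x \<in> cube J"
    show "F x \<in> X"
    proof (cases "g x \<le> 1/2")
      case True
      then show ?thesis using imA[of x] x G(2) by (auto simp: F_def A_def)
    next
      case False
      then have "p x \<in> {0..1} \<times> cube_boundary J" using imB[of x] x by (auto simp: B_def)
      then show ?thesis using h(2) False by (auto simp: F_def)
    qed
  qed
  moreover have "F x = h (0, x)" if "x \<in> cube_boundary J" for x
    using cube_gauge_boundary[OF J that] by (simp add: F_def p_def g_def)
  ultimately show ?thesis using that by blast
qed

text \<open>The composite of \<open>f\<close> with \<open>\<rho>\<close> extends over the cube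
  inside \<open>Y\<close>, and \<open>\<iota>\<close> carries the extension to \<open>X\<close>.
  There it restricts to \<open>f\<close> followed by \<open>\<rho>\<close> and
  \<open>\<iota>\<close> instead of \<open>f\<close>; the homotopy \<open>h\<close> makes up for the
  difference in the outer shell.\<close>

lemma cube_connected_homotopy_dominated:
  fixes X :: "'a::topological_space set" and Y :: "'b::topological_space set"
  assumes Y: "cube_connected n Y"
    and \<rho>: "continuous_on X \<rho>" "\<rho> ` X \<subseteq> Y"
    and \<iota>: "continuous_on Y \<iota>" "\<iota> ` Y \<subseteq> X"
    and h: "continuous_on ({0..1::real} \<times> X) h" "h ` ({0..1} \<times> X) \<subseteq> X"
      "\<And>x. x \<in> X \<Longrightarrow> h (0, x) = x" "\<And>x. x \<in> X \<Longrightarrow> h (1, x) = \<iota> (\<rho> x)"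
  shows "cube_connected n X"
  unfolding cube_connected_def
proof (intro allI impI)
  fix J and f :: "(nat \<Rightarrow> real) \<Rightarrow> 'a"
  assume J: "finite J" "int (card J) \<le> n + 1"
    and f: "continuous_on (cube_boundary J) f" "f ` cube_boundary J \<subseteq> X"
  have "continuous_on (cube_boundary J) (\<lambda>x. \<rho> (f x))" "(\<lambda>x. \<rho> (f x)) ` cube_boundary J \<subseteq> Y"
    using f \<rho> by (auto intro: continuous_on_compose2)
  then obtain G where G: "continuous_on (cube J) G" "G ` cube J \<subseteq> Y"
    "\<And>x. x \<in> cube_boundary J \<Longrightarrow> G x = \<rho> (f x)"
    using cube_connectedD[OF Y J] by metis
  define H where "H p = h (fst p, f (snd p))" for p :: "real \<times> (nat \<Rightarrow> real)"
  have 1: "continuous_on ({0..1} \<times> cube_boundary J) H" unfolding H_def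
    by (rule continuous_on_compose2[OF h(1)])
      (use f in \<open>auto intro!: continuous_on_Pair continuous_on_fst continuous_on_id
        continuous_on_compose2[OF f(1) continuous_on_snd[OF continuous_on_id]]\<close>)
  have 2: "H ` ({0..1} \<times> cube_boundary J) \<subseteq> X"
    using h(2) f(2) by (simp add: image_subset_iff H_def)
  have 3: "continuous_on (cube J) (\<lambda>x. \<iota> (G x))" "(\<lambda>x. \<iota> (G x)) ` cube J \<subseteq> X"
    using G \<iota> by (auto intro: continuous_on_compose2)
  have 4: "H (1, x) = \<iota> (G x)" if "x \<in> cube_boundary J" for x
    using that h(4)[of "f x"] f(2) G(3) by (auto simp: H_def)
  obtain F where F: "continuous_on (cube J) F" "F ` cube J \<subseteq> X"
    "\<And>x. x \<in> cube_boundary J \<Longrightarrow> F x = H (0, x)"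
    using cube_extension_homotopy[OF J(1) 1 2 3 4] by metis
  moreover have "H (0, x) = f x" if "x \<in> cube_boundary J" for x
    using that h(3)[of "f x"] f(2) by (auto simp: H_def)
  ultimately show "\<exists>F. continuous_on (cube J) F \<and> F ` cube J \<subseteq> X \<and> (\<forall>x\<in>cube_boundary J. F x = f x)"
    by auto
qed

lemma cube_connected_contractible:
  fixes X :: "'a::topological_space set"
  assumes "a \<in> X" and h: "continuous_on ({0..1::real} \<times> X) h" "h ` ({0..1} \<times> X) \<subseteq> X"
      "\<And>x. x \<in> X \<Longrightarrow> h (0, x) = x" "\<And>x. x \<in> X \<Longrightarrow> h (1, x) = a"
  shows "cube_connected n X"
proof (rule cube_connected_homotopy_dominated[where Y = "{a}" and \<rho> = "\<lambda>_. a" and \<iota> = "\<lambda>_. a", OF _ _ _ _ _ h(1-3)])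
  show "cube_connected n {a}"
    unfolding cube_connected_def
  proof (intro allI impI exI[of _ "\<lambda>_. a"] conjI ballI)
    fix J and f :: "(nat \<Rightarrow> real) \<Rightarrow> 'a" and x
    assume "f ` cube_boundary J \<subseteq> {a}" "x \<in> cube_boundary J"
    then show "a = f x" by blast
  qed auto
qed (use assms(1,5) in \<open>simp_all add: image_subset_iff\<close>)

text \<open>An affine change of coordinates. Degenerate sides are allowed because a grid cell fixes
  all but finitely many of the infinitely many coordinates.\<close>

lemma cube_connected_box:
  fixes a b :: "nat \<Rightarrow> real"
  defines "bx \<equiv> {x. \<forall>j. a j \<le> x j \<and> x j \<le> b j}"
  defines "bd \<equiv> {x \<in> bx. \<exists>j. a j < b j \<and> (x j = a j \<or> x j = b j)}"
  assumes X: "cube_connected n X" and ab: "\<And>j. a j \<le> b j"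
    and J: "finite {j. a j < b j}" "int (card {j. a j < b j}) \<le> n + 1"
    and f: "continuous_on bd f" "f ` bd \<subseteq> X"
  shows "\<exists>F. continuous_on bx F \<and> F ` bx \<subseteq> X \<and> (\<forall>x\<in>bd. F x = f x)"
proof -
  define J where "J = {j. a j < b j}"
  \<comment> \<open>In a degenerate direction the division by zero gives 0, as \<open>cube\<close>
    requires outside \<open>J\<close>, and \<open>\<psi>\<close> returns the common value of
    \<open>a\<close> and \<open>b\<close>.\<close>
  define \<phi> where "\<phi> x = (\<lambda>j. (2 * x j - a j - b j) / (b j - a j))" for x :: "nat \<Rightarrow> real"
  define \<psi> where "\<psi> y = (\<lambda>j. (a j + b j + y j * (b j - a j)) / 2)" for y :: "nat \<Rightarrow> real"
  have c\<phi>: "continuous_on S \<phi>" for S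
    unfolding \<phi>_def
  proof (rule continuous_on_coordinatewise_then_product)
    fix j show "continuous_on S (\<lambda>x. (2 * x j - a j - b j) / (b j - a j))"
      by (cases "a j = b j") (auto intro!: continuous_intros continuous_on_coord)
  qed
  have c\<psi>: "continuous_on S \<psi>" for S
    unfolding \<psi>_def by (intro continuous_intros) auto
  have \<psi>\<phi>: "\<psi> (\<phi> x) = x" if "x \<in> bx" for x
  proof
    fix j
    have "a j \<le> x j" "x j \<le> b j" using that by (auto simp: bx_def)
    then show "\<psi> (\<phi> x) j = x j"
      unfolding \<psi>_def \<phi>_def
      by (cases "a j = b j") (auto simp: field_simps)
  qed
  have bound: "\<bar>(2 * u - p - q) / (q - p)\<bar> \<le> 1" if "p < q" "p \<le> u" "u \<le> q" for u p q :: real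
    using that by (auto simp: abs_le_iff field_simps)
  have bound2: "p \<le> (p + q + y * (q - p)) / 2 \<and> (p + q + y * (q - p)) / 2 \<le> q" 
    if "p \<le> q" "\<bar>y\<bar> \<le> 1" for p q y :: real
  proof -
    have "(q - p) * (1 - y) \<ge> 0" "(q - p) * (1 + y) \<ge> 0" using that by auto
    then show ?thesis by (auto simp: algebra_simps)
  qed
  have \<phi>im: "\<phi> x \<in> cube J" if "x \<in> bx" for x
  proof -
    have "\<bar>\<phi> x j\<bar> \<le> 1" if "j \<in> J" for j
      using that \<open>x \<in> bx\<close> unfolding \<phi>_def J_def bx_def by (intro bound) auto
    moreover have "\<phi> x j = 0" if "j \<notin> J" for j
      using that ab[of j] by (simp add: J_def \<phi>_def)
    ultimately show ?thesis by (simp add: cube_def)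
  qed
  have \<psi>im: "\<psi> y \<in> bx" if "y \<in> cube J" for y
  proof -
    have "a j \<le> \<psi> y j \<and> \<psi> y j \<le> b j" for j
      using that bound2[OF ab, of "y j" j] unfolding \<psi>_def cube_def by (cases "j \<in> J") auto
    then show ?thesis by (auto simp: bx_def)
  qed
  have \<psi>bd: "\<psi> y \<in> bd" if y: "y \<in> cube_boundary J" for y
  proof -
    obtain j where "j \<in> J" "\<bar>y j\<bar> = 1" using y by (auto simp: cube_boundary_def)
    then have "a j < b j" "\<psi> y j = a j \<or> \<psi> y j = b j"
      by (auto simp: J_def \<psi>_def abs_eq_iff' field_simps)
    then show ?thesis using \<psi>im[of y] y by (auto simp: bd_def cube_boundary_def)
  qed
  have \<phi>bd: "\<phi> x \<in> cube_boundary J" if x: "x \<in> bd" for x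
  proof -
    obtain j where j: "a j < b j" "x j = a j \<or> x j = b j" "x \<in> bx" using x by (auto simp: bd_def)
    then have "\<bar>\<phi> x j\<bar> = 1" by (auto simp: \<phi>_def field_simps)
    then show ?thesis using j \<phi>im[of x] by (auto simp: cube_boundary_def J_def)
  qed
  have "finite J" "int (card J) \<le> n + 1" using assms(5,6) by (simp_all add: J_def)
  moreover have "continuous_on (cube_boundary J) (\<lambda>y. f (\<psi> y))" "(\<lambda>y. f (\<psi> y)) ` cube_boundary J \<subseteq> X"
    using f \<psi>bd by (auto intro!: continuous_on_compose2[OF f(1) c\<psi>])
  ultimately obtain G where G: "continuous_on (cube J) G" "G ` cube J \<subseteq> X"
    "\<And>y. y \<in> cube_boundary J \<Longrightarrow> G y = f (\<psi> y)"
    using cube_connectedD[OF X, of J "\<lambda>y. f (\<psi> y)"] by metis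
  show ?thesis
  proof (intro exI[of _ "\<lambda>x. G (\<phi> x)"] conjI ballI)
    show "continuous_on bx (\<lambda>x. G (\<phi> x))"
      by (rule continuous_on_compose2[OF G(1) c\<phi>]) (use \<phi>im in auto)
    show "(\<lambda>x. G (\<phi> x)) ` bx \<subseteq> X" using G(2) \<phi>im by (simp add: image_subset_iff)
    show "G (\<phi> x) = f x" if "x \<in> bd" for x
      using G(3)[OF \<phi>bd[OF that]] \<psi>\<phi>[of x] that by (auto simp: bd_def)
  qed
qed

section \<open>Cubical grids\<close>

text \<open>A cell of the cubical grid of mesh \<open>h\<close> is encoded coordinatewise by integers: \<open>2 * i\<close> stands
  for the point \<open>h * i\<close> and \<open>2 * i + 1\<close> for the interval from \<open>h * i\<close> to \<open>h * (i + 1)\<close>.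
  Then floor plus ceiling encodes the cell that contains a point in its relative interior.\<close>

definition grid_cell :: "real \<Rightarrow> (nat \<Rightarrow> int) \<Rightarrow> (nat \<Rightarrow> real) set"
  where "grid_cell h e =
    {x. \<forall>j. h * of_int (e j div 2) \<le> x j \<and> x j \<le> h * of_int ((e j + 1) div 2)}"

text \<open>Passing to a face replaces some intervals (odd codes) by one of their ends (the
  neighbouring even codes).\<close>

definition grid_face :: "(nat \<Rightarrow> int) \<Rightarrow> (nat \<Rightarrow> int) \<Rightarrow> bool"
  where "grid_face d e \<longleftrightarrow> (\<forall>j. d j = e j \<or> odd (e j) \<and> (d j = e j - 1 \<or> d j = e j + 1))"

definition grid_carrier :: "real \<Rightarrow> (nat \<Rightarrow> real) \<Rightarrow> nat \<Rightarrow> int"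
  where "grid_carrier h x = (\<lambda>j. \<lfloor>x j / h\<rfloor> + \<lceil>x j / h\<rceil>)"

definition grid_complex :: "(nat \<Rightarrow> int) set \<Rightarrow> bool"
  where "grid_complex P \<longleftrightarrow> finite P \<and> (\<forall>e\<in>P. \<forall>d. grid_face d e \<longrightarrow> d \<in> P)"

text \<open>Defined by carriers rather than as a union of closed cells, so that unions and
  intersections of sets of codes become those of regions at once.\<close>

definition grid_region :: "real \<Rightarrow> (nat \<Rightarrow> int) set \<Rightarrow> (nat \<Rightarrow> real) set"
  where "grid_region h P = {x. grid_carrier h x \<in> P}"

text \<open>One coordinate of the fact that a closed cell is the union of the relative interiors of
  its faces: an interval consists of its interior and two ends, a point only of itself.\<close>

lemma floor_ceiling_cell_iff:
  fixes y :: real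
  shows "(of_int (e div 2) \<le> y \<and> y \<le> of_int ((e + 1) div 2)) \<longleftrightarrow>
    (\<lfloor>y\<rfloor> + \<lceil>y\<rceil> = e \<or> odd e \<and> (\<lfloor>y\<rfloor> + \<lceil>y\<rceil> = e - 1 \<or> \<lfloor>y\<rfloor> + \<lceil>y\<rceil> = e + 1))"
proof -
  have *: "(e div 2 \<le> f \<and> g \<le> (e + 1) div 2) \<longleftrightarrow>
    (f + g = e \<or> odd e \<and> (f + g = e - 1 \<or> f + g = e + 1))"
    if "f \<le> g" "g \<le> f + 1" for f g :: int
  proof (cases "even e")
    case True
    then obtain i where "e = 2 * i" by blast
    moreover have "(2 * i + 1) div 2 = i" by simp
    ultimately show ?thesis using that by (simp only: nonzero_mult_div_cancel_left dvd_triv_left) auto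
  next
    case False
    then obtain i where "e = 2 * i + 1" by (rule oddE)
    moreover have "(2 * i + 1 + 1) div 2 = i + 1" "(2 * i + 1) div 2 = i" by auto
    ultimately show ?thesis using that False by auto
  qed
  have "\<lfloor>y\<rfloor> \<le> \<lceil>y\<rceil>" "\<lceil>y\<rceil> \<le> \<lfloor>y\<rfloor> + 1" by linarith+
  from *[OF this] show ?thesis by (simp add: le_floor_iff ceiling_le_iff)
qed

lemma grid_cell_iff:
  assumes "h > 0"
  shows "x \<in> grid_cell h e \<longleftrightarrow> grid_face (grid_carrier h x) e"
proof -
  have "x \<in> grid_cell h e \<longleftrightarrow> (\<forall>j. of_int (e j div 2) \<le> x j / h \<and> x j / h \<le> of_int ((e j + 1) div 2))"
    using assms by (simp add: grid_cell_def field_simps)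
  then show ?thesis
    by (simp only: floor_ceiling_cell_iff grid_face_def grid_carrier_def)
qed

lemma grid_face_refl: "grid_face e e"
  by (simp add: grid_face_def)

lemma mem_grid_cell_carrier: "h > 0 \<Longrightarrow> x \<in> grid_cell h (grid_carrier h x)"
  by (simp add: grid_cell_iff grid_face_refl)

lemma grid_face_trans:
  assumes "grid_face c d" "grid_face d e"
  shows "grid_face c e"
  unfolding grid_face_def
proof
  fix j
  show "c j = e j \<or> odd (e j) \<and> (c j = e j - 1 \<or> c j = e j + 1)"
  proof (cases "d j = e j")
    case True
    then show ?thesis using assms(1) unfolding grid_face_def by metis
  next
    case False
    then have "odd (e j) \<and> (d j = e j - 1 \<or> d j = e j + 1)" using assms(2) unfolding grid_face_def by metis
    then have "even (d j)" by auto
    then have "c j = d j" using assms(1) unfolding grid_face_def by metis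
    then show ?thesis using \<open>odd (e j) \<and> (d j = e j - 1 \<or> d j = e j + 1)\<close> by simp
  qed
qed

lemma grid_cell_mono: "h > 0 \<Longrightarrow> grid_face d e \<Longrightarrow> grid_cell h d \<subseteq> grid_cell h e"
  by (auto simp: grid_cell_iff intro: grid_face_trans)

lemma grid_face_card_less:
  assumes "grid_face d e" "d \<noteq> e" "finite {j. odd (e j)}"
  shows "card {j. odd (d j)} < card {j. odd (e j)}"
proof (rule psubset_card_mono[OF assms(3)])
  obtain j where "d j \<noteq> e j" using assms(2) by auto
  then have "odd (e j)" "even (d j)" using assms(1) unfolding grid_face_def by (metis, metis even_add even_diff odd_one)
  moreover have "{j. odd (d j)} \<subseteq> {j. odd (e j)}"
    using assms(1) unfolding grid_face_def by (metis Collect_mono)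
  ultimately show "{j. odd (d j)} \<subset> {j. odd (e j)}" by auto
qed

lemma closed_grid_cell: "closed (grid_cell h e)"
proof -
  have "grid_cell h e = (\<Inter>j. {x. h * of_int (e j div 2) \<le> x j} \<inter> {x. x j \<le> h * of_int ((e j + 1) div 2)})"
    by (auto simp: grid_cell_def)
  moreover have "closed {x::nat\<Rightarrow>real. c \<le> x j}" "closed {x::nat\<Rightarrow>real. x j \<le> c}" for j c
    by (intro closed_Collect_le continuous_intros)+
  ultimately show ?thesis by (simp only:) (intro closed_INT closed_Int ballI)
qed

lemma grid_region_eq:
  assumes "h > 0" "grid_complex P"
  shows "grid_region h P = (\<Union>e\<in>P. grid_cell h e)"
  using assms mem_grid_cell_carrier[OF assms(1)]
  by (auto simp: grid_region_def grid_cell_iff grid_complex_def)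

lemma closed_grid_region:
  assumes "h > 0" "grid_complex P"
  shows "closed (grid_region h P)"
  unfolding grid_region_eq[OF assms] using assms(2)
  by (intro closed_UN) (auto simp: grid_complex_def closed_grid_cell)

text \<open>Cells are added in order of dimension: a missing cell of least dimension has all its
  proper faces in \<open>Q\<close>, so the map is given on its whole boundary and extends by
  \<open>cube_connected_box\<close>.\<close>

lemma grid_extension:
  fixes f :: "(nat \<Rightarrow> real) \<Rightarrow> 'a::topological_space"
  assumes h: "h > 0" and X: "cube_connected n X"
    and P: "grid_complex P" and Q: "grid_complex Q" "Q \<subseteq> P"
    and dim: "\<And>e. e \<in> P - Q \<Longrightarrow> finite {j. odd (e j)} \<and> int (card {j. odd (e j)}) \<le> n + 1"
    and f: "continuous_on (grid_region h Q) f" "f ` grid_region h Q \<subseteq> X"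
  shows "\<exists>F. continuous_on (grid_region h P) F \<and> F ` grid_region h P \<subseteq> X \<and>
    (\<forall>x\<in>grid_region h Q. F x = f x)"
  using Q dim f
proof (induction "card (P - Q)" arbitrary: Q f rule: less_induct)
    case less
    show ?case
    proof (cases "P - Q = {}")
      case True
      then have "P = Q" using less.prems by auto
      then show ?thesis using less.prems by auto
    next
      case False
      have finP: "finite P" using P by (simp add: grid_complex_def)
      obtain c where c: "c \<in> P - Q"
        and cmin: "\<And>e. e \<in> P - Q \<Longrightarrow> card {j. odd (c j)} \<le> card {j. odd (e j)}"
        using False ex_has_least_nat[of "\<lambda>e. e \<in> P - Q" _ "\<lambda>e. card {j. odd (e j)}"] by blast
      define a where "a j = h * of_int (c j div 2)" for j
      define b where "b j = h * of_int ((c j + 1) div 2)" for j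
      have ab: "a j \<le> b j" for j unfolding a_def b_def using h by (simp add: zdiv_mono1)
      have lt: "a j < b j \<longleftrightarrow> odd (c j)" for j
      proof -
        have "c j div 2 < (c j + 1) div 2 \<longleftrightarrow> odd (c j)" by presburger
        then show ?thesis unfolding a_def b_def using h by simp
      qed
      have cell: "grid_cell h c = {x. \<forall>j. a j \<le> x j \<and> x j \<le> b j}"
        by (simp add: grid_cell_def a_def b_def)
      have sub_face: "e \<in> Q" if "grid_face e c" "e \<noteq> c" for e
      proof (rule ccontr)
        assume "e \<notin> Q"
        then have "e \<in> P - Q" using P c that by (auto simp: grid_complex_def)
        then show False using cmin[of e] grid_face_card_less[OF that] less.prems(3)[OF c] by simp
      qed
      define bd where "bd = {x \<in> {x. \<forall>j. a j \<le> x j \<and> x j \<le> b j}. \<exists>j. a j < b j \<and> (x j = a j \<or> x j = b j)}"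
      have bd_carrier: "grid_carrier h x \<noteq> c" if x: "x \<in> bd" for x
      proof -
        obtain j where j: "a j < b j" "x j = a j \<or> x j = b j" using x by (auto simp: bd_def)
        then have "even (grid_carrier h x j)" "odd (c j)"
          using h lt by (auto simp: grid_carrier_def a_def b_def)
        then show ?thesis by auto
      qed
      have bdQ: "bd \<subseteq> grid_region h Q"
      proof
        fix x assume x: "x \<in> bd"
        then have "grid_face (grid_carrier h x) c" 
          using cell grid_cell_iff[OF h, of x c] by (auto simp: bd_def)
        then show "x \<in> grid_region h Q"
          using sub_face bd_carrier[OF x] by (auto simp: grid_region_def)
      qed
      have cellQ: "x \<in> bd" if x: "x \<in> grid_cell h c" "x \<in> grid_region h Q" for x
      proof -
        \<comment> \<open>Only the relative interior of the cell has carrier \<open>c\<close>. So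
          some interval coordinate of \<open>c\<close> has an even code at \<open>x\<close>, and
          there \<open>x j\<close> is one of the two ends of the interval.\<close>
        have "grid_carrier h x \<noteq> c" using x(2) c by (auto simp: grid_region_def)
        then obtain j where j: "grid_carrier h x j \<noteq> c j" by auto
        then have oj: "odd (c j)" "grid_carrier h x j = c j - 1 \<or> grid_carrier h x j = c j + 1"
          using x(1) unfolding grid_cell_iff[OF h] grid_face_def by metis+
        let ?y = "x j / h"
        have fg: "\<lfloor>?y\<rfloor> \<le> \<lceil>?y\<rceil>" "\<lceil>?y\<rceil> \<le> \<lfloor>?y\<rfloor> + 1" by linarith+
        have ev: "even (\<lfloor>?y\<rfloor> + \<lceil>?y\<rceil>)"
        proof -
          have "even (grid_carrier h x j)" using oj by auto
          then show ?thesis unfolding grid_carrier_def .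
        qed
        have "F = G" if "even (F + G)" "F \<le> G" "G \<le> F + 1" for F G :: int
          using that by presburger
        from this[OF ev fg] have eq: "\<lfloor>?y\<rfloor> = \<lceil>?y\<rceil>" .
        then have y: "?y = of_int \<lfloor>?y\<rfloor>" by linarith
        have halves: "F = e div 2 \<or> F = (e + 1) div 2" if "F + F = e - 1 \<or> F + F = e + 1" for F e :: int
          using that by linarith
        have "\<lfloor>?y\<rfloor> + \<lfloor>?y\<rfloor> = c j - 1 \<or> \<lfloor>?y\<rfloor> + \<lfloor>?y\<rfloor> = c j + 1"
          using oj(2) eq unfolding grid_carrier_def by simp
        from halves[OF this] have "\<lfloor>?y\<rfloor> = c j div 2 \<or> \<lfloor>?y\<rfloor> = (c j + 1) div 2" .
        moreover have "x j = h * of_int \<lfloor>?y\<rfloor>"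
          unfolding y[symmetric] using h by simp
        ultimately have "x j = a j \<or> x j = b j"
          unfolding a_def b_def by auto
        then show ?thesis using x(1) oj(1) lt cell by (auto simp: bd_def)
      qed
      have "continuous_on bd f" "f ` bd \<subseteq> X"
        using less.prems(4,5) bdQ by (auto intro: continuous_on_subset)
      then have "\<exists>E. continuous_on (grid_cell h c) E \<and> E ` grid_cell h c \<subseteq> X \<and> (\<forall>x\<in>bd. E x = f x)"
        unfolding cell bd_def
        by (intro cube_connected_box[OF X ab]) (use less.prems(3)[OF c] in \<open>simp_all add: lt\<close>)
      then obtain E where E: "continuous_on (grid_cell h c) E" "E ` grid_cell h c \<subseteq> X"
        "\<And>x. x \<in> bd \<Longrightarrow> E x = f x"
        by blast
      define Q' where "Q' = insert c Q"
      have Q': "grid_complex Q'" "Q' \<subseteq> P"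
        using less.prems(1,2) c sub_face by (auto simp: Q'_def grid_complex_def)
      define f' where "f' x = (if x \<in> grid_cell h c then E x else f x)" for x
      have reg: "grid_region h Q' = grid_cell h c \<union> grid_region h Q"
        unfolding grid_region_eq[OF h Q'(1)] grid_region_eq[OF h less.prems(1)] by (simp add: Q'_def)
      have cf': "continuous_on (grid_region h Q') f'"
        unfolding reg f'_def
        by (rule continuous_on_If[OF closed_grid_cell closed_grid_region[OF h less.prems(1)] E(1) less.prems(4)])
          (use E(3) cellQ in auto)
      have "card (P - Q') < card (P - Q)"
        using c finP by (intro psubset_card_mono) (auto simp: Q'_def)
      moreover have "f' ` grid_region h Q' \<subseteq> X"
        unfolding reg f'_def using E(2) less.prems(5) by auto
      ultimately obtain F where F: "continuous_on (grid_region h P) F" "F ` grid_region h P \<subseteq> X"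
        "\<forall>x\<in>grid_region h Q'. F x = f' x"
        using less.hyps[OF _ Q' _ cf'] less.prems(3) by (auto simp: Q'_def)
      moreover have "F x = f x" if "x \<in> grid_region h Q" for x
        using F(3) that reg E(3) cellQ by (auto simp: f'_def)
      ultimately show ?thesis by blast
    qed
qed

section \<open>Gluing along open sets\<close>

lemma dist_fun_le_sup:
  fixes x y :: "nat \<Rightarrow> real"
  assumes "\<And>j. \<bar>x j - y j\<bar> \<le> \<epsilon>"
  shows "dist x y \<le> 2 * \<epsilon>"
proof -
  \<comment> \<open>The metric on functions weights the coordinates by powers of 1/2, which add up
    to 2.\<close>
  have s: "summable (\<lambda>n. (1/2)^n * \<epsilon>)" "suminf (\<lambda>n. (1/2)^n * \<epsilon>) = 2 * \<epsilon>"
    using sums_mult2[OF geometric_sums[of "1/2::real"], of \<epsilon>] by (auto simp: sums_iff)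
  have le: "(1/2)^n * min (dist (x (from_nat n)) (y (from_nat n))) 1 \<le> (1/2)^n * \<epsilon>" for n
    using assms[of "from_nat n"] by (intro mult_left_mono) (auto simp: dist_real_def)
  have s': "summable (\<lambda>n. (1/2)^n * min (dist (x (from_nat n)) (y (from_nat n))) 1)"
    by (rule summable_comparison_test'[OF s(1)]) (use le in \<open>auto simp: abs_mult\<close>)
  have "dist x y \<le> suminf (\<lambda>n. (1/2)^n * \<epsilon>)"
    unfolding dist_fun_def by (rule suminf_le[OF le s' s(1)])
  then show ?thesis using s(2) by simp
qed

lemma dist_grid_cell:
  assumes "h > 0" "x \<in> grid_cell h e" "y \<in> grid_cell h e"
  shows "dist x y \<le> 2 * h"
proof (rule dist_fun_le_sup)
  fix j
  have "(e j + 1) div 2 \<le> e j div 2 + 1" by presburger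
  then have "of_int ((e j + 1) div 2) \<le> (of_int (e j div 2) + 1 :: real)" by linarith
  then have "h * of_int ((e j + 1) div 2) \<le> h * of_int (e j div 2) + h"
    using assms(1) by (metis distrib_left mult.right_neutral mult_left_mono less_imp_le)
  moreover have "h * of_int (e j div 2) \<le> x j" "x j \<le> h * of_int ((e j + 1) div 2)"
    "h * of_int (e j div 2) \<le> y j" "y j \<le> h * of_int ((e j + 1) div 2)"
    using assms(2,3) by (auto simp: grid_cell_def)
  ultimately show "\<bar>x j - y j\<bar> \<le> h" by linarith
qed

text \<open>The cells of the boundary of the cube that \<open>f\<close> maps into \<open>W\<close> are pushed into \<open>U \<inter> W\<close>, relative to
  the cells mapped into \<open>U\<close>; this is possible since their dimension is below that of the cube.
  The pushed map extends inside \<open>U\<close>, and it is homotopic to \<open>f\<close> since the product of these cells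
  with an interval has small enough dimension for extensions inside \<open>W\<close>.\<close>

theorem cube_connected_open_Un:
  fixes U W :: "'a::topological_space set"
  assumes oU: "openin (top_of_set (U \<union> W)) U" and oW: "openin (top_of_set (U \<union> W)) W"
    and cU: "cube_connected n U" and cW: "cube_connected n W"
    and cUW: "cube_connected (n - 1) (U \<inter> W)"
  shows "cube_connected n (U \<union> W)"
  unfolding cube_connected_def
proof (intro allI impI)
  fix J and f :: "(nat \<Rightarrow> real) \<Rightarrow> 'a"
  assume J: "finite J" "int (card J) \<le> n + 1"
    and f: "continuous_on (cube_boundary J) f" "f ` cube_boundary J \<subseteq> U \<union> W"
  define bd where "bd = cube_boundary J"
  have "openin (top_of_set bd) (bd \<inter> f -` U)" "openin (top_of_set bd) (bd \<inter> f -` W)"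
    unfolding bd_def using continuous_openin_preimage[OF f(1) _ oU] continuous_openin_preimage[OF f(1) _ oW] f(2)
    by (simp_all add: image_subset_iff Pi_iff)
  then obtain OU OW where O: "open OU" "bd \<inter> f -` U = bd \<inter> OU" "open OW" "bd \<inter> f -` W = bd \<inter> OW"
    unfolding openin_open by metis
  have bdO: "bd \<subseteq> \<Union>{OU, OW}"
  proof
    fix x assume x: "x \<in> bd"
    then have "f x \<in> U \<or> f x \<in> W" using f(2) by (auto simp: bd_def)
    then show "x \<in> \<Union>{OU, OW}" using O(2,4) x by auto
  qed
  have "compact bd" unfolding bd_def by (rule compact_cube_boundary[OF J(1)])
  moreover have "open G" if "G \<in> {OU, OW}" for G using that O(1,3) by auto
  \<comment> \<open>A Lebesgue number of the cover: every cell of diameter below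
    \<open>\<epsilon>\<close> is mapped entirely into \<open>U\<close> or entirely into
    \<open>W\<close>.\<close>
  ultimately obtain \<epsilon> where \<epsilon>: "\<epsilon> > 0" "\<And>x. x \<in> bd \<Longrightarrow> \<exists>G\<in>{OU, OW}. ball x \<epsilon> \<subseteq> G"
    using Heine_Borel_lemma[OF _ bdO] by metis
  obtain N :: nat where N: "N > 0" "2 / real N < \<epsilon>"
  proof -
    obtain N :: nat where "real N > 2 / \<epsilon>" using reals_Archimedean2 by blast
    moreover have "2 / \<epsilon> > 0" using \<epsilon>(1) by simp
    ultimately have N: "real N > 0" "2 / \<epsilon> < real N" by linarith+
    then have "2 / real N < \<epsilon>" using \<epsilon>(1) by (simp add: pos_divide_less_eq mult.commute)
    with N have "N > 0" "2 / real N < \<epsilon>" by simp_all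
    then show ?thesis using that by blast
  qed
  define h where "h = 1 / real N"
  have h: "h > 0" using N by (simp add: h_def)
  have xh: "x / h = x * real N" for x using N by (simp add: h_def)
  \<comment> \<open>The cells of mesh \<open>1/N\<close> in the boundary: code \<open>2 * N\<close>
    or \<open>- 2 * N\<close> pins a coordinate to 1 or -1.\<close>
  define E where "E = {e. (\<forall>j. (j \<in> J \<longrightarrow> e j \<in> {- 2 * int N..2 * int N}) \<and> (j \<notin> J \<longrightarrow> e j = 0)) \<and>
    (\<exists>j\<in>J. \<bar>e j\<bar> = 2 * int N)}"
  have Efin: "finite E"
    by (rule finite_subset[OF _ finite_set_of_finite_funs[OF J(1), of "{- 2 * int N..2 * int N}" 0]])
      (auto simp: E_def)
  have Eface: "d \<in> E" if e: "e \<in> E" and d: "grid_face d e" for d e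
  proof -
    have "d j \<in> {- 2 * int N..2 * int N}" if "j \<in> J" for j
    proof -
      have "e j \<in> {- 2 * int N..2 * int N}" using e that by (simp add: E_def)
      moreover have "d j = e j \<or> odd (e j) \<and> (d j = e j - 1 \<or> d j = e j + 1)" 
        using d by (simp add: grid_face_def)
      moreover have "e j \<noteq> 2 * int N \<and> e j \<noteq> - 2 * int N" if "odd (e j)" using that by auto
      ultimately show ?thesis by auto
    qed
    moreover have "d j = 0" if "j \<notin> J" for j
    proof -
      have "e j = 0" using e that by (simp add: E_def)
      then show ?thesis using d unfolding grid_face_def by (metis even_zero)
    qed
    moreover obtain j where "j \<in> J" "\<bar>e j\<bar> = 2 * int N" using e by (auto simp: E_def)
    moreover from this have "even (e j)" by (metis dvd_abs_iff dvd_triv_left)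
    then have "d j = e j" using d unfolding grid_face_def by metis
    ultimately show ?thesis unfolding E_def by (auto intro: bexI[of _ j])
  qed
  have regE: "grid_region h E = bd"
  proof (rule Set.set_eqI)
    fix x
    have 1: "grid_carrier h x j \<in> {- 2 * int N..2 * int N} \<longleftrightarrow> \<bar>x j\<bar> \<le> 1" for j
    proof -
      let ?y = "x j * real N"
      have "\<lfloor>?y\<rfloor> \<le> \<lceil>?y\<rceil>" "\<lceil>?y\<rceil> \<le> \<lfloor>?y\<rfloor> + 1" by linarith+
      then have "\<lfloor>?y\<rfloor> + \<lceil>?y\<rceil> \<in> {- 2 * int N..2 * int N} \<longleftrightarrow> - int N \<le> \<lfloor>?y\<rfloor> \<and> \<lceil>?y\<rceil> \<le> int N"
        unfolding atLeastAtMost_iff by linarith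
      also have "\<dots> \<longleftrightarrow> - real N \<le> ?y \<and> ?y \<le> real N"
        by (simp add: le_floor_iff ceiling_le_iff)
      also have "\<dots> \<longleftrightarrow> (-1) * real N \<le> ?y \<and> ?y \<le> 1 * real N" by simp
      also have "\<dots> \<longleftrightarrow> \<bar>x j\<bar> \<le> 1"
        using N(1) by (simp only: mult_le_cancel_right_pos of_nat_0_less_iff abs_le_iff) linarith
      finally show ?thesis by (simp add: grid_carrier_def xh)
    qed
    have 2: "grid_carrier h x j = 0 \<longleftrightarrow> x j = 0" for j
    proof -
      let ?y = "x j * real N"
      have "\<lfloor>?y\<rfloor> \<le> \<lceil>?y\<rceil>" "\<lceil>?y\<rceil> \<le> \<lfloor>?y\<rfloor> + 1" by linarith+
      then have "\<lfloor>?y\<rfloor> + \<lceil>?y\<rceil> = 0 \<longleftrightarrow> 0 \<le> \<lfloor>?y\<rfloor> \<and> \<lceil>?y\<rceil> \<le> 0" by linarith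
      also have "\<dots> \<longleftrightarrow> ?y = 0" by (auto simp: le_floor_iff ceiling_le_iff)
      finally show ?thesis using N(1) by (simp add: grid_carrier_def xh)
    qed
    have 3: "\<bar>grid_carrier h x j\<bar> = 2 * int N \<longleftrightarrow> \<bar>x j\<bar> = 1" if "\<bar>x j\<bar> \<le> 1" for j
    proof
      assume "\<bar>x j\<bar> = 1"
      then have "x j = 1 \<or> x j = -1" by linarith
      moreover have "\<lfloor>- real N\<rfloor> = - int N" "\<lceil>- real N\<rceil> = - int N" by linarith+
      ultimately show "\<bar>grid_carrier h x j\<bar> = 2 * int N" by (auto simp: grid_carrier_def xh)
    next
      assume a: "\<bar>grid_carrier h x j\<bar> = 2 * int N"
      let ?y = "x j * real N"
      have fg: "\<lfloor>?y\<rfloor> \<le> \<lceil>?y\<rceil>" "\<lceil>?y\<rceil> \<le> \<lfloor>?y\<rfloor> + 1" by linarith+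
      have "\<lfloor>?y\<rfloor> + \<lceil>?y\<rceil> = 2 * int N \<or> \<lfloor>?y\<rfloor> + \<lceil>?y\<rceil> = - 2 * int N"
        using a by (auto simp: grid_carrier_def xh)
      then have "\<lfloor>?y\<rfloor> \<ge> int N \<or> \<lceil>?y\<rceil> \<le> - int N" using fg by linarith
      then have "?y \<ge> 1 * real N \<or> ?y \<le> (-1) * real N" by (simp add: le_floor_iff ceiling_le_iff)
      then have "x j \<ge> 1 \<or> x j \<le> -1" using N(1) by (simp only: mult_le_cancel_right) auto
      then show "\<bar>x j\<bar> = 1" using that by linarith
    qed
    show "x \<in> grid_region h E \<longleftrightarrow> x \<in> bd"
      unfolding grid_region_def E_def bd_def cube_boundary_def cube_def mem_Collect_eq
      using 1 2 3 by metis
  qed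
  have cellE: "grid_cell h e \<subseteq> bd" if "e \<in> E" for e
    using that Eface h unfolding regE[symmetric] grid_region_def by (auto simp: grid_cell_iff)
  define CU where "CU = {e \<in> E. f ` grid_cell h e \<subseteq> U}"
  define CW where "CW = {e \<in> E. f ` grid_cell h e \<subseteq> W}"
  have gCU: "grid_complex CU" and gCW: "grid_complex CW"
    using Efin Eface grid_cell_mono[OF h] unfolding CU_def CW_def grid_complex_def by (auto, blast+)
  have gCUW: "grid_complex (CU \<inter> CW)" using gCU gCW by (auto simp: grid_complex_def)
  have ECUW: "E = CU \<union> CW"
  proof -
    have "e \<in> CU \<union> CW" if e: "e \<in> E" for e
    proof -
      define x where "x j = h * of_int (e j div 2)" for j
      have x: "x \<in> grid_cell h e" using h by (simp add: grid_cell_def x_def zdiv_mono1)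
      then have "x \<in> bd" using cellE[OF e] by (rule rev_subsetD)
      from \<epsilon>(2)[OF this] obtain G where G: "G \<in> {OU, OW}" "ball x \<epsilon> \<subseteq> G" by blast
      have "dist x y < \<epsilon>" if "y \<in> grid_cell h e" for y
        using dist_grid_cell[OF h x that] N(2) by (simp add: h_def)
      then have "grid_cell h e \<subseteq> bd \<inter> G" using G(2) cellE[OF e] by auto
      then show ?thesis using G(1) O e unfolding CU_def CW_def by blast
    qed
    then show ?thesis by (auto simp: CU_def CW_def)
  qed
  have bdCUW: "bd = grid_region h CU \<union> grid_region h CW"
    unfolding regE[symmetric] ECUW grid_region_def by auto
  have fU: "f x \<in> U" if "x \<in> grid_region h CU" for x
    using that mem_grid_cell_carrier[OF h, of x] by (auto simp: grid_region_def CU_def)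
  have fW: "f x \<in> W" if "x \<in> grid_region h CW" for x
    using that mem_grid_cell_carrier[OF h, of x] by (auto simp: grid_region_def CW_def)
  have cf: "continuous_on S f" if "S \<subseteq> bd" for S
    using continuous_on_subset[OF f(1)] that by (simp add: bd_def)
  have regInt: "grid_region h (CU \<inter> CW) = grid_region h CU \<inter> grid_region h CW"
    by (auto simp: grid_region_def)
  have oddE: "\<exists>j\<in>J. {i. odd (e i)} \<subseteq> J - {j}" if e: "e \<in> E" for e
  proof -
    obtain j where j: "j \<in> J" "\<bar>e j\<bar> = 2 * int N" using e by (auto simp: E_def)
    then have "even (e j)" by (metis dvd_abs_iff dvd_triv_left)
    moreover have "i \<in> J" if "odd (e i)" for i
    proof (rule ccontr)
      assume "i \<notin> J"
      then have "e i = 0" using e by (simp add: E_def)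
      with that show False by simp
    qed
    ultimately show ?thesis using j(1) by blast
  qed
  have dimE: "finite {i. odd (e i)}" "int (card {i. odd (e i)}) \<le> n - 1 + 1" if e: "e \<in> E" for e
  proof -
    obtain j where j: "j \<in> J" "{i. odd (e i)} \<subseteq> J - {j}" using oddE[OF e] by blast
    then show "finite {i. odd (e i)}" using J(1) by (auto intro: finite_subset)
    have "card {i. odd (e i)} \<le> card (J - {j})" using j J(1) by (intro card_mono) auto
    moreover have "card (J - {j}) < card J" using j(1) J(1) by (intro psubset_card_mono) auto
    ultimately show "int (card {i. odd (e i)}) \<le> n - 1 + 1" using J(2) by linarith
  qed
  have "\<exists>g. continuous_on (grid_region h CW) g \<and> g ` grid_region h CW \<subseteq> U \<inter> W \<and>
    (\<forall>x\<in>grid_region h (CU \<inter> CW). g x = f x)"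
  proof (rule grid_extension[OF h cUW gCW gCUW, of f])
    show "continuous_on (grid_region h (CU \<inter> CW)) f" by (rule cf) (auto simp: bdCUW regInt)
    show "f ` grid_region h (CU \<inter> CW) \<subseteq> U \<inter> W" unfolding regInt using fU fW by blast
    show "finite {j. odd (e j)} \<and> int (card {j. odd (e j)}) \<le> n - 1 + 1" if "e \<in> CW - CU \<inter> CW" for e
      using that dimE[of e] ECUW by auto
  qed auto
  then obtain g where g: "continuous_on (grid_region h CW) g" "g ` grid_region h CW \<subseteq> U \<inter> W"
    "\<And>x. x \<in> grid_region h (CU \<inter> CW) \<Longrightarrow> g x = f x"
    by blast
  define f' where "f' x = (if x \<in> grid_region h CU then f x else g x)" for x
  have cf': "continuous_on bd f'"
    unfolding bdCUW f'_def
    by (rule continuous_on_If[OF closed_grid_region[OF h gCU] closed_grid_region[OF h gCW] cf g(1)])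
      (use g(3) regInt bdCUW in auto)
  moreover have "f' ` bd \<subseteq> U"
    using fU g(2) unfolding bdCUW f'_def by auto
  ultimately obtain G where G: "continuous_on (cube J) G" "G ` cube J \<subseteq> U" "\<And>x. x \<in> bd \<Longrightarrow> G x = f' x"
    using cube_connectedD[OF cU J, of f'] unfolding bd_def by metis
  \<comment> \<open>A coordinate outside \<open>J\<close> serves as time axis: the codes 0, 1, 2
    stand for its start 0, the interval up to \<open>h\<close>, and its end
    \<open>h\<close>.\<close>
  obtain j0 where j0: "j0 \<notin> J" using J(1) ex_new_if_finite infinite_UNIV_nat by metis
  define P where "P = {e. e(j0 := 0) \<in> CW \<and> e j0 \<in> {0, 1, 2}}"
  \<comment> \<open>In the product of \<open>CW\<close> with the time interval, the map is
    prescribed as \<open>f\<close> at the start and over the cells of \<open>CU\<close> (this is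
    \<open>Q0\<close>), and as \<open>g\<close> at the end (this is \<open>Q2\<close>).\<close>
  define Q0 where "Q0 = {e \<in> P. e j0 = 0 \<or> e(j0 := 0) \<in> CU}"
  define Q2 where "Q2 = {e \<in> P. e j0 = 2}"
  have facej0: "grid_face (d(j0 := 0)) (e(j0 := 0))" if "grid_face d e" for d e
    using that by (auto simp: grid_face_def)
  have facej0': "d j0 = e j0 \<or> odd (e j0) \<and> (d j0 = e j0 - 1 \<or> d j0 = e j0 + 1)" if "grid_face d e" for d e
    using that by (auto simp: grid_face_def)
  have finP: "finite P"
  proof (rule finite_subset)
    show "P \<subseteq> (\<lambda>(e, t). e(j0 := t)) ` (CW \<times> {0, 1, 2})"
      by (auto simp: P_def image_iff intro!: bexI[of _ "(_(j0 := 0), _)"]) (metis fun_upd_triv fun_upd_upd)+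
    show "finite ((\<lambda>(e, t::int). e(j0 := t)) ` (CW \<times> {0, 1, 2}))"
      using gCW by (auto simp: grid_complex_def)
  qed
  have CWf: "d(j0 := 0) \<in> CW" if "grid_face d e" "e(j0 := 0) \<in> CW" for d e
    using gCW facej0[OF that(1)] that(2) by (auto simp: grid_complex_def)
  have CUf: "d(j0 := 0) \<in> CU" if "grid_face d e" "e(j0 := 0) \<in> CU" for d e
    using gCU facej0[OF that(1)] that(2) by (auto simp: grid_complex_def)
  have gP: "grid_complex P" unfolding grid_complex_def
  proof (intro conjI finP ballI allI impI)
    fix e d assume "e \<in> P" "grid_face d e"
    then show "d \<in> P" using CWf facej0'[of d e] unfolding P_def by auto
  qed
  have gQ0: "grid_complex Q0" unfolding grid_complex_def
  proof (intro conjI ballI allI impI)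
    show "finite Q0" using finP by (simp add: Q0_def)
    fix e d assume "e \<in> Q0" "grid_face d e"
    then show "d \<in> Q0" using CUf facej0'[of d e] gP unfolding Q0_def grid_complex_def by auto
  qed
  have gQ2: "grid_complex Q2" unfolding grid_complex_def
  proof (intro conjI ballI allI impI)
    show "finite Q2" using finP by (simp add: Q2_def)
    fix e d assume "e \<in> Q2" "grid_face d e"
    then show "d \<in> Q2" using facej0'[of d e] gP unfolding Q2_def grid_complex_def by auto
  qed
  have gQ: "grid_complex (Q0 \<union> Q2)" "Q0 \<union> Q2 \<subseteq> P"
    using gQ0 gQ2 by (simp add: grid_complex_def, blast) (simp add: Q0_def Q2_def)
  define p where "p x = x(j0 := 0::real)" for x :: "nat \<Rightarrow> real"
  have cp: "continuous_on S p" for S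
  proof (rule continuous_on_coordinatewise_then_product)
    fix i show "continuous_on S (\<lambda>x. p x i)"
      by (cases "i = j0") (auto simp: p_def intro: continuous_on_coord)
  qed
  have carp: "grid_carrier h (p x) = (grid_carrier h x)(j0 := 0)" for x
    by (auto simp: grid_carrier_def p_def)
  have pW: "p x \<in> grid_region h CW" if "x \<in> grid_region h P" for x
    using that by (simp add: grid_region_def carp P_def)
  define \<phi> where "\<phi> x = (if x \<in> grid_region h Q0 then f (p x) else g (p x))" for x
  have Q0P: "grid_region h Q0 \<subseteq> grid_region h P" and Q2P: "grid_region h Q2 \<subseteq> grid_region h P"
    by (auto simp: grid_region_def Q0_def Q2_def)
  have regQ: "grid_region h (Q0 \<union> Q2) = grid_region h Q0 \<union> grid_region h Q2"
    by (auto simp: grid_region_def)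
  have fg: "g x = f x" if "x \<in> grid_region h CU" "x \<in> grid_region h CW" for x
    using g(3) that regInt by auto
  have c\<phi>: "continuous_on (grid_region h (Q0 \<union> Q2)) \<phi>"
    unfolding regQ \<phi>_def
  proof (rule continuous_on_If[OF closed_grid_region[OF h gQ0] closed_grid_region[OF h gQ2]])
    show "continuous_on (grid_region h Q0) (\<lambda>x. f (p x))"
      by (rule continuous_on_compose2[OF cf[of "grid_region h CW"] cp]) (use pW Q0P bdCUW in auto)
    show "continuous_on (grid_region h Q2) (\<lambda>x. g (p x))"
      by (rule continuous_on_compose2[OF g(1) cp]) (use pW Q2P in auto)
    fix x assume x: "x \<in> grid_region h Q2" "x \<in> grid_region h Q0"
    then have "p x \<in> grid_region h CU" by (auto simp: grid_region_def carp Q0_def Q2_def)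
    then show "f (p x) = g (p x)" using fg pW x Q2P by auto
  qed auto
  have \<phi>W: "\<phi> ` grid_region h (Q0 \<union> Q2) \<subseteq> W"
    using pW fW g(2) Q0P Q2P unfolding regQ \<phi>_def by (auto simp: image_subset_iff subset_iff)
  have "\<exists>\<Phi>. continuous_on (grid_region h P) \<Phi> \<and> \<Phi> ` grid_region h P \<subseteq> W \<and>
    (\<forall>x\<in>grid_region h (Q0 \<union> Q2). \<Phi> x = \<phi> x)"
  proof (rule grid_extension[OF h cW gP gQ _ c\<phi> \<phi>W])
    fix e assume "e \<in> P - (Q0 \<union> Q2)"
    then have e: "e(j0 := 0) \<in> E" using ECUW by (auto simp: P_def)
    have sub: "{i. odd (e i)} \<subseteq> insert j0 {i. odd ((e(j0 := 0)) i)}" by auto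
    have fin: "finite {i. odd ((e(j0 := 0)) i)}" by (rule dimE(1)[OF e])
    have "card {i. odd (e i)} \<le> card (insert j0 {i. odd ((e(j0 := 0)) i)})"
      using sub fin by (intro card_mono) auto
    also have "\<dots> \<le> Suc (card {i. odd ((e(j0 := 0)) i)})" by (rule card_insert_le_m1) auto
    finally have "int (card {i. odd (e i)}) \<le> n + 1" using dimE(2)[OF e] by linarith
    then show "finite {j. odd (e j)} \<and> int (card {j. odd (e j)}) \<le> n + 1"
      using sub fin by (auto intro: finite_subset)
  qed
  then obtain \<Phi> where \<Phi>: "continuous_on (grid_region h P) \<Phi>" "\<Phi> ` grid_region h P \<subseteq> W"
    "\<And>x. x \<in> grid_region h (Q0 \<union> Q2) \<Longrightarrow> \<Phi> x = \<phi> x"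
    by blast
  \<comment> \<open>Time in \<open>{0..1}\<close> is rescaled to one mesh width.\<close>
  define q where "q = (\<lambda>(t :: real, x :: nat \<Rightarrow> real). x(j0 := t * h))"
  define H where "H = (\<lambda>(t, x). if x \<in> grid_region h CU then f x else \<Phi> (q (t, x)))"
  have cq: "continuous_on S q" for S
  proof (rule continuous_on_coordinatewise_then_product)
    fix i
    have "continuous_on S (\<lambda>z::real \<times> (nat \<Rightarrow> real). snd z i)"
      by (rule continuous_on_product_then_coordinatewise) (intro continuous_intros)
    then show "continuous_on S (\<lambda>z. q z i)"
      by (cases "i = j0") (auto simp: q_def case_prod_beta intro!: continuous_intros)
  qed
  have carq: "grid_carrier h (q (t, x)) = (grid_carrier h x)(j0 := \<lfloor>t\<rfloor> + \<lceil>t\<rceil>)" for t x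
    using h by (auto simp: grid_carrier_def q_def)
  have bdj0: "x j0 = 0" if "x \<in> bd" for x
    using that j0 by (auto simp: bd_def cube_boundary_def cube_def)
  have carj0: "(grid_carrier h x)(j0 := 0) = grid_carrier h x" if "x \<in> bd" for x
    using bdj0[OF that] by (auto simp: grid_carrier_def)
  have floors: "\<lfloor>t\<rfloor> + \<lceil>t\<rceil> \<in> {0, 1, 2}" if "0 \<le> t" "t \<le> 1" for t :: real
  proof -
    have "0 \<le> \<lfloor>t\<rfloor>" "\<lfloor>t\<rfloor> \<le> \<lceil>t\<rceil>" "\<lceil>t\<rceil> \<le> 1" using that by linarith+
    then have "\<lfloor>t\<rfloor> + \<lceil>t\<rceil> = 0 \<or> \<lfloor>t\<rfloor> + \<lceil>t\<rceil> = 1 \<or> \<lfloor>t\<rfloor> + \<lceil>t\<rceil> = 2" by linarith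
    then show ?thesis by simp
  qed
  have qP: "q (t, x) \<in> grid_region h P" if "t \<in> {0..1}" "x \<in> grid_region h CW" for t x
  proof -
    have "x \<in> bd" using that bdCUW by auto
    then show ?thesis using carj0[of x] that floors[of t] by (simp add: grid_region_def carq P_def)
  qed
  have pq: "p (q (t, x)) = x" if "x \<in> bd" for t x
    using bdj0[OF that] by (auto simp: p_def q_def)
  have qQ0: "q (t, x) \<in> grid_region h Q0" 
    if "t \<in> {0..1}" "x \<in> grid_region h CW" "t = 0 \<or> x \<in> grid_region h CU" for t x
  proof -
    have "x \<in> bd" using that bdCUW by auto
    then show ?thesis using carj0[of x] qP[of t x] that by (auto simp: grid_region_def carq Q0_def)
  qed
  have \<Phi>Q0: "\<Phi> (q (t, x)) = f x" 
    if "t \<in> {0..1}" "x \<in> grid_region h CW" "t = 0 \<or> x \<in> grid_region h CU" for t x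
    using qQ0[OF that] \<Phi>(3)[of "q (t, x)"] pq[of x t] that(2) bdCUW by (auto simp: regQ \<phi>_def)
  have \<Phi>Q2: "\<Phi> (q (1, x)) = g x" if x: "x \<in> grid_region h CW" for x
  proof -
    have xbd: "x \<in> bd" using x bdCUW by auto
    have Q2: "q (1, x) \<in> grid_region h Q2"
      using qP[of 1 x] x by (auto simp: grid_region_def carq Q2_def)
    show ?thesis
    proof (cases "q (1, x) \<in> grid_region h Q0")
      case True
      then have "x \<in> grid_region h CU" using carj0[OF xbd] by (auto simp: grid_region_def carq Q0_def)
      then show ?thesis using \<Phi>Q0[of 1 x] fg x by auto
    next
      case False
      then show ?thesis using \<Phi>(3)[of "q (1, x)"] Q2 pq[OF xbd] by (auto simp: regQ \<phi>_def)
    qed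
  qed
  have H_alt: "H = (\<lambda>z. if z \<in> {0..1} \<times> grid_region h CU \<or> snd z \<in> grid_region h CU then f (snd z) else \<Phi> (q z))"
    by (auto simp: H_def)
  have cH: "continuous_on ({0..1} \<times> cube_boundary J) H"
  proof -
    have "continuous_on ({0..1} \<times> grid_region h CU \<union> {0..1} \<times> grid_region h CW) H"
      unfolding H_alt
    proof (rule continuous_on_If)
      show "closed ({0..1::real} \<times> grid_region h CU)" "closed ({0..1::real} \<times> grid_region h CW)"
        using closed_grid_region[OF h] gCU gCW by (auto intro!: closed_Times)
      show "continuous_on ({0..1::real} \<times> grid_region h CU) (\<lambda>z. f (snd z))"
        by (rule continuous_on_compose2[OF cf[of "grid_region h CU"] continuous_on_snd[OF continuous_on_id]])
          (use bdCUW in auto)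
      show "continuous_on ({0..1} \<times> grid_region h CW) (\<lambda>z. \<Phi> (q z))"
        by (rule continuous_on_compose2[OF \<Phi>(1) cq]) (use qP in auto)
      fix z :: "real \<times> (nat \<Rightarrow> real)" assume "z \<in> {0..1} \<times> grid_region h CW"
        "z \<in> {0..1} \<times> grid_region h CU \<or> snd z \<in> grid_region h CU"
      then show "f (snd z) = \<Phi> (q z)" using \<Phi>Q0[of "fst z" "snd z"] by (cases z) auto
    qed auto
    moreover have "{0..1} \<times> grid_region h CU \<union> {0..1} \<times> grid_region h CW = {0..1::real} \<times> cube_boundary J"
      using bdCUW unfolding bd_def by auto
    ultimately show ?thesis by simp
  qed
  have HX: "H ` ({0..1} \<times> cube_boundary J) \<subseteq> U \<union> W"
  proof -
    have "H (t, x) \<in> U \<union> W" if t: "t \<in> {0..1}" and x: "x \<in> bd" for t x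
    proof (cases "x \<in> grid_region h CU")
      case True
      then show ?thesis using fU by (simp add: H_def)
    next
      case False
      then have "q (t, x) \<in> grid_region h P" using qP t x bdCUW by auto
      then show ?thesis using False \<Phi>(2) by (auto simp: H_def)
    qed
    then show ?thesis unfolding bd_def by (auto simp: image_subset_iff)
  qed
  have GX: "G ` cube J \<subseteq> U \<union> W" using G(2) by (rule order_trans) simp
  have HG: "H (1, x) = G x" if "x \<in> cube_boundary J" for x
    using that G(3)[of x] \<Phi>Q2[of x] bdCUW by (auto simp: H_def f'_def bd_def)
  have H0: "H (0, x) = f x" if "x \<in> cube_boundary J" for x
    using that \<Phi>Q0[of 0 x] bdCUW by (auto simp: H_def bd_def)
  obtain F where "continuous_on (cube J) F" "F ` cube J \<subseteq> U \<union> W"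
    "\<And>x. x \<in> cube_boundary J \<Longrightarrow> F x = H (0, x)"
    using cube_extension_homotopy[OF J(1) cH HX G(1) GX HG] by metis
  then show "\<exists>F. continuous_on (cube J) F \<and> F ` cube J \<subseteq> U \<union> W \<and> (\<forall>x\<in>cube_boundary J. F x = f x)"
    using H0 by (intro exI[of _ F]) simp
qed

section \<open>Geometric realizations\<close>

definition realization :: "'v set set \<Rightarrow> ('v \<Rightarrow> real) set"
  where "realization K =
    {x. (\<forall>v. 0 \<le> x v) \<and> {v. x v \<noteq> 0} \<in> K \<and> (\<Sum>v | x v \<noteq> 0. x v) = 1}"

lemma geometric_realization_eq: "geometric_realization K = top_of_set (realization K)"
  by (simp add: geometric_realization_def realization_def euclidean_product_topology)

text \<open>The support in \<open>realization\<close> varies with the point; summing over the fixed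
  set \<open>V\<close> makes the last condition linear in \<open>x\<close>.\<close>

lemma mem_realization_iff:
  assumes "finite V" "K \<subseteq> Pow V"
  shows "x \<in> realization K \<longleftrightarrow> (\<forall>v. 0 \<le> x v) \<and> {v. x v \<noteq> 0} \<in> K \<and> sum x V = 1"
proof -
  have "(\<Sum>v | x v \<noteq> 0. x v) = sum x V" if "{v. x v \<noteq> 0} \<in> K"
    using that assms by (intro sum.mono_neutral_left) auto
  then show ?thesis by (auto simp: realization_def)
qed

lemma segment_in_realization:
  assumes V: "finite V" "K \<subseteq> Pow V" and K: "\<And>A B. A \<in> K \<Longrightarrow> B \<subseteq> A \<Longrightarrow> B \<in> K"
    and x: "x \<in> realization K" and y: "y \<in> realization K"
    and xy: "{v. x v \<noteq> 0} \<union> {v. y v \<noteq> 0} \<in> K" and t: "0 \<le> t" "t \<le> 1"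
  shows "(\<lambda>v. (1 - t) * x v + t * y v) \<in> realization K"
proof -
  have "{v. (1 - t) * x v + t * y v \<noteq> 0} \<subseteq> {v. x v \<noteq> 0} \<union> {v. y v \<noteq> 0}" by auto
  then have "{v. (1 - t) * x v + t * y v \<noteq> 0} \<in> K" using K[OF xy] by simp
  moreover have "(\<Sum>v\<in>V. (1 - t) * x v + t * y v) = (1 - t) * sum x V + t * sum y V"
    by (simp add: sum.distrib sum_distrib_left)
  ultimately show ?thesis
    using x y t unfolding mem_realization_iff[OF V] by auto
qed

lemma continuous_on_straight_line:
  fixes F :: "('v \<Rightarrow> real) \<Rightarrow> 'v \<Rightarrow> real"
  assumes "continuous_on X F"
  shows "continuous_on ({0..1::real} \<times> X) (\<lambda>z v. (1 - fst z) * snd z v + fst z * F (snd z) v)"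
proof (rule continuous_on_coordinatewise_then_product)
  fix v
  have 1: "continuous_on ({0..1::real} \<times> X) (\<lambda>z. snd z v)"
    by (rule continuous_on_product_then_coordinatewise) (intro continuous_intros)
  have "continuous_on ({0..1::real} \<times> X) (\<lambda>z. F (snd z))"
    by (rule continuous_on_compose2[OF assms]) (auto intro: continuous_intros)
  then have 2: "continuous_on ({0..1::real} \<times> X) (\<lambda>z. F (snd z) v)"
    by (rule continuous_on_product_then_coordinatewise)
  have 3: "continuous_on ({0..1::real} \<times> X) (\<lambda>z. fst z)" by (intro continuous_intros)
  show "continuous_on ({0..1::real} \<times> X) (\<lambda>z. (1 - fst z) * snd z v + fst z * F (snd z) v)"
    using 1 2 3 by (intro continuous_on_add continuous_on_mult continuous_on_diff continuous_on_const)
qed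

lemma cube_connected_straight_line:
  fixes X :: "('v \<Rightarrow> real) set" and Y :: "'b::topological_space set"
  assumes Y: "cube_connected n Y"
    and \<rho>: "continuous_on X \<rho>" "\<rho> ` X \<subseteq> Y" and \<iota>: "continuous_on Y \<iota>" "\<iota> ` Y \<subseteq> X"
    and line: "\<And>x t. x \<in> X \<Longrightarrow> 0 \<le> t \<Longrightarrow> t \<le> 1 \<Longrightarrow> (\<lambda>v. (1 - t) * x v + t * \<iota> (\<rho> x) v) \<in> X"
  shows "cube_connected n X"
proof (rule cube_connected_homotopy_dominated[OF Y \<rho> \<iota>])
  have "continuous_on X (\<lambda>x. \<iota> (\<rho> x))"
    by (rule continuous_on_compose2[OF \<iota>(1) \<rho>])
  then show "continuous_on ({0..1::real} \<times> X) (\<lambda>z v. (1 - fst z) * snd z v + fst z * \<iota> (\<rho> (snd z)) v)"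
    by (rule continuous_on_straight_line)
  show "(\<lambda>z v. (1 - fst z) * snd z v + fst z * \<iota> (\<rho> (snd z)) v) ` ({0..1} \<times> X) \<subseteq> X"
    using line by (simp add: image_subset_iff)
qed auto

text \<open>The segment from a point to the apex \<open>v\<close> stays in the simplex spanned by
  \<open>v\<close> and the support of the point.\<close>

lemma cube_connected_cone:
  assumes V: "finite V" "K \<subseteq> Pow V" and K: "\<And>A B. A \<in> K \<Longrightarrow> B \<subseteq> A \<Longrightarrow> B \<in> K"
    and cone: "\<And>A. A \<in> K \<Longrightarrow> insert v A \<in> K" and ne: "{} \<in> K"
  shows "cube_connected n (realization K)"
proof -
  define a where "a w = (if w = v then 1 else 0 :: real)" for w
  have vK: "{v} \<in> K" using cone[OF ne] by simp
  have supp: "{w. a w \<noteq> 0} = {v}" by (auto simp: a_def)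
  have "sum a V = 1" using V vK by (auto simp: a_def)
  then have aK: "a \<in> realization K"
    using vK unfolding mem_realization_iff[OF V] supp by (auto simp: a_def)
  show ?thesis
  proof (rule cube_connected_contractible[OF aK])
    show "continuous_on ({0..1} \<times> realization K) (\<lambda>z w. (1 - fst z) * snd z w + fst z * a w)"
      by (rule continuous_on_straight_line) (rule continuous_on_const)
    show "(\<lambda>z w. (1 - fst z) * snd z w + fst z * a w) ` ({0..1} \<times> realization K) \<subseteq> realization K"
    proof -
      have "(\<lambda>w. (1 - t) * x w + t * a w) \<in> realization K" if "0 \<le> t" "t \<le> 1" "x \<in> realization K" for t x
      proof -
        have "{w. x w \<noteq> 0} \<in> K" using that(3) by (simp add: realization_def)
        from cone[OF this] have xa: "{w. x w \<noteq> 0} \<union> {w. a w \<noteq> 0} \<in> K" unfolding supp by simp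
        show ?thesis by (rule segment_in_realization[OF V K that(3) aK xa that(1,2)])
      qed
      then show ?thesis by (simp add: image_subset_iff)
    qed
  qed auto
qed

text \<open>The points with \<open>x v < 1\<close> are pushed away from \<open>v\<close> onto the
  deletion, the points with \<open>0 < x v\<close> form the open star and contract to
  \<open>v\<close>, and the overlap deforms to a copy of the link. Both sets are open, so
  \<open>cube_connected_open_Un\<close> applies; it asks one degree less of the overlap, hence of
  the link.\<close>

lemma cube_connected_vertex:
  assumes V: "finite V" "K \<subseteq> Pow V" and K: "\<And>A B. A \<in> K \<Longrightarrow> B \<subseteq> A \<Longrightarrow> B \<in> K"
    and del: "cube_connected n (realization {A \<in> K. v \<notin> A})"
    and lnk: "{v} \<in> K \<Longrightarrow> cube_connected (n - 1) (realization {A. v \<notin> A \<and> insert v A \<in> K})"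
  shows "cube_connected n (realization K)"
proof (cases "{v} \<in> K")
  case False
  then have "{A \<in> K. v \<notin> A} = K" using K by (metis (no_types, lifting) Collect_cong Collect_mem_eq empty_subsetI insert_subset)
  then show ?thesis using del by simp
next
  case True
  define R where "R = realization K"
  define U where "U = {x \<in> R. x v < 1}"
  define W where "W = {x \<in> R. 0 < x v}"
  define D where "D = {A \<in> K. v \<notin> A}"
  define L where "L = {A. v \<notin> A \<and> insert v A \<in> K}"
  have vV: "v \<in> V" using True V by auto
  have DV: "D \<subseteq> Pow V" and LV: "L \<subseteq> Pow V" using V K by (auto simp: D_def L_def)
  note Riff = mem_realization_iff[OF V, folded R_def]
  note Diff = mem_realization_iff[OF V(1) DV] and Liff = mem_realization_iff[OF V(1) LV]
  have seg: "(\<lambda>w. (1 - t) * x w + t * y w) \<in> R"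
    if "x \<in> R" "y \<in> R" "{w. x w \<noteq> 0} \<union> {w. y w \<noteq> 0} \<in> K" "0 \<le> t" "t \<le> 1" for x y t
    using segment_in_realization[OF V K that(1)[unfolded R_def] that(2)[unfolded R_def] that(3-5)]
    by (simp add: R_def)
  have supp: "{w. x w \<noteq> 0} \<in> K" if "x \<in> R" for x using that by (simp add: Riff)
  \<comment> \<open>Projection from the vertex \<open>v\<close>: its coordinate is dropped and the
    others are rescaled to sum 1.\<close>
  define \<rho> where "\<rho> x w = (if w = v then 0 else x w / (1 - x v))" for x :: "'a \<Rightarrow> real" and w
  \<comment> \<open>Points of the link have \<open>x v = 0\<close> and so lie outside
    \<open>W\<close>; the link is embedded halfway towards \<open>v\<close>.\<close>
  define \<iota> where "\<iota> x w = (if w = v then 1/2 else x w / 2)" for x :: "'a \<Rightarrow> real" and w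
  have supp\<rho>: "{w. \<rho> x w \<noteq> 0} = {w. x w \<noteq> 0} - {v}" if "x \<in> U" for x
    using that by (auto simp: \<rho>_def U_def)
  have sum\<rho>: "(\<forall>w. 0 \<le> \<rho> x w) \<and> sum (\<rho> x) V = 1" if x: "x \<in> U" for x
  proof -
    have "sum x V = 1" "x v < 1" "\<forall>w. 0 \<le> x w" using x by (auto simp: U_def Riff)
    then have "sum x (V - {v}) = 1 - x v" using V(1) vV by (simp add: sum_diff1)
    moreover have "sum (\<rho> x) V = sum (\<rho> x) (V - {v})"
      using V(1) by (intro sum.mono_neutral_right) (auto simp: \<rho>_def)
    moreover have "sum (\<rho> x) (V - {v}) = sum x (V - {v}) / (1 - x v)"
      unfolding sum_divide_distrib by (intro sum.cong) (auto simp: \<rho>_def)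
    ultimately show ?thesis using \<open>x v < 1\<close> \<open>\<forall>w. 0 \<le> x w\<close> by (auto simp: \<rho>_def)
  qed
  have \<rho>D: "\<rho> x \<in> realization D" if x: "x \<in> U" for x
  proof -
    have "{w. x w \<noteq> 0} \<in> K" using x supp by (simp add: U_def)
    from K[OF this Diff_subset] have "{w. x w \<noteq> 0} - {v} \<in> K" .
    then show ?thesis using sum\<rho>[OF x] unfolding Diff supp\<rho>[OF x] by (simp add: D_def)
  qed
  have \<rho>L: "\<rho> x \<in> realization L" if x: "x \<in> U \<inter> W" for x
  proof -
    have "{w. x w \<noteq> 0} \<in> K" using x supp by (simp add: U_def)
    moreover have "insert v ({w. x w \<noteq> 0} - {v}) = {w. x w \<noteq> 0}" using x by (auto simp: W_def)
    ultimately have "{w. x w \<noteq> 0} - {v} \<in> L" by (simp add: L_def)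
    then show ?thesis using sum\<rho>[of x] x supp\<rho>[of x] unfolding Liff by simp
  qed
  have c\<rho>: "continuous_on S \<rho>" if "S \<subseteq> U" for S
  proof (rule continuous_on_coordinatewise_then_product)
    fix w show "continuous_on S (\<lambda>x. \<rho> x w)"
      using that by (cases "w = v") (auto simp: \<rho>_def U_def intro!: continuous_intros)
  qed
  have c\<iota>: "continuous_on S \<iota>" for S
  proof (rule continuous_on_coordinatewise_then_product)
    fix w show "continuous_on S (\<lambda>x. \<iota> x w)"
      by (cases "w = v") (auto simp: \<iota>_def intro!: continuous_intros)
  qed
  have DR: "realization D \<subseteq> R" by (auto simp: R_def realization_def D_def)
  have Dv: "x v = 0" if "x \<in> realization D" for x using that by (auto simp: realization_def D_def)
  have "R = U \<union> W" by (auto simp: U_def W_def)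
  moreover have "openin (top_of_set R) U"
  proof -
    have "open {x::'a \<Rightarrow> real. x v < 1}" by (intro open_Collect_less continuous_intros)
    moreover have "U = R \<inter> {x. x v < 1}" by (auto simp: U_def)
    ultimately show ?thesis by (simp add: openin_open_Int)
  qed
  moreover have "openin (top_of_set R) W"
  proof -
    have "open {x::'a \<Rightarrow> real. 0 < x v}" by (intro open_Collect_less continuous_intros)
    moreover have "W = R \<inter> {x. 0 < x v}" by (auto simp: W_def)
    ultimately show ?thesis by (simp add: openin_open_Int)
  qed
  moreover have "cube_connected n U"
  proof (rule cube_connected_straight_line[where \<rho> = \<rho> and \<iota> = "\<lambda>x. x", OF del[folded D_def]])
    show "\<rho> ` U \<subseteq> realization D" using \<rho>D by blast
    show "(\<lambda>x. x) ` realization D \<subseteq> U"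
    proof
      fix x assume "x \<in> (\<lambda>x. x) ` realization D"
      then have "x \<in> realization D" by simp
      then show "x \<in> U" using DR Dv[of x] unfolding U_def by auto
    qed
    fix x :: "'a \<Rightarrow> real" and t :: real assume x: "x \<in> U" "0 \<le> t" "t \<le> 1"
    have "{w. x w \<noteq> 0} \<union> {w. \<rho> x w \<noteq> 0} = {w. x w \<noteq> 0}" using supp\<rho>[OF x(1)] by auto
    then have "(\<lambda>w. (1 - t) * x w + t * \<rho> x w) \<in> R"
      using seg[of x "\<rho> x" t] x \<rho>D[OF x(1)] DR supp[of x] by (auto simp: U_def)
    moreover have "(1 - t) * x v + t * \<rho> x v < 1"
    proof -
      have "0 \<le> x v" "x v < 1" using x(1) by (auto simp: U_def Riff)
      then have "(1 - t) * x v \<le> 1 * x v" using x(2) by (intro mult_right_mono) auto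
      then show ?thesis using \<open>x v < 1\<close> by (simp add: \<rho>_def)
    qed
    ultimately show "(\<lambda>w. (1 - t) * x w + t * \<rho> x w) \<in> U" by (simp add: U_def)
  qed (auto intro: c\<rho>)
  moreover have "cube_connected n W"
  proof -
    define a where "a w = (if w = v then 1 else 0 :: real)" for w
    have suppa: "{w. a w \<noteq> 0} = {v}" by (auto simp: a_def)
    have "sum a V = 1" using V(1) vV by (auto simp: a_def)
    then have aR: "a \<in> R" using True unfolding Riff suppa by (auto simp: a_def)
    show ?thesis
    proof (rule cube_connected_contractible)
      show "a \<in> W" using aR by (simp add: W_def a_def)
      show "continuous_on ({0..1} \<times> W) (\<lambda>z w. (1 - fst z) * snd z w + fst z * a w)"
        by (rule continuous_on_straight_line) (rule continuous_on_const)
      have "(\<lambda>w. (1 - t) * x w + t * a w) \<in> W" if t: "0 \<le> t" "t \<le> 1" and x: "x \<in> W" for t x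
      proof -
        have "{w. x w \<noteq> 0} \<union> {w. a w \<noteq> 0} = {w. x w \<noteq> 0}" using x unfolding suppa by (auto simp: W_def)
        then have "(\<lambda>w. (1 - t) * x w + t * a w) \<in> R"
          using seg[of x a t] x t aR supp[of x] by (auto simp: W_def)
        moreover have "0 < (1 - t) * x v + t * a v"
        proof (cases "t = 1")
          case False
          then have "0 < (1 - t) * x v" using t x by (auto simp: W_def)
          then show ?thesis using t by (simp add: a_def)
        qed (simp add: a_def)
        ultimately show ?thesis by (simp add: W_def)
      qed
      then show "(\<lambda>z w. (1 - fst z) * snd z w + fst z * a w) ` ({0..1} \<times> W) \<subseteq> W"
        by (simp add: image_subset_iff)
    qed auto
  qed
  moreover have "cube_connected (n - 1) (U \<inter> W)"
  proof (rule cube_connected_straight_line[where \<rho> = \<rho> and \<iota> = \<iota>, OF lnk[OF True, folded L_def]])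
    show "\<rho> ` (U \<inter> W) \<subseteq> realization L" using \<rho>L by blast
    have \<iota>R: "\<iota> y \<in> U \<inter> W \<and> {w. \<iota> y w \<noteq> 0} = insert v {w. y w \<noteq> 0}" if y: "y \<in> realization L" for y
    proof -
      have yv: "y v = 0" and yL: "insert v {w. y w \<noteq> 0} \<in> K" using y by (auto simp: realization_def L_def)
      have supp\<iota>: "{w. \<iota> y w \<noteq> 0} = insert v {w. y w \<noteq> 0}" by (auto simp: \<iota>_def)
      have "sum (\<iota> y) V = \<iota> y v + sum (\<iota> y) (V - {v})" using V(1) vV by (simp add: sum.remove)
      also have "sum (\<iota> y) (V - {v}) = sum y (V - {v}) / 2"
        unfolding sum_divide_distrib by (intro sum.cong) (auto simp: \<iota>_def)
      also have "sum y (V - {v}) = sum y V" using V(1) vV yv by (simp add: sum_diff1)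
      finally have "sum (\<iota> y) V = 1" using y by (simp add: Liff \<iota>_def)
      moreover have "\<forall>w. 0 \<le> \<iota> y w" using y by (simp add: Liff \<iota>_def)
      ultimately have "\<iota> y \<in> R" using yL unfolding Riff supp\<iota> by simp
      then show ?thesis using supp\<iota> by (simp add: U_def W_def \<iota>_def)
    qed
    then show "\<iota> ` realization L \<subseteq> U \<inter> W" by blast
    fix x :: "'a \<Rightarrow> real" and t :: real assume x: "x \<in> U \<inter> W" and t: "0 \<le> t" "t \<le> 1"
    note i = \<iota>R[OF \<rho>L[OF x]]
    have "{w. \<iota> (\<rho> x) w \<noteq> 0} = insert v ({w. x w \<noteq> 0} - {v})"
      using i supp\<rho>[of x] x by simp
    moreover have "v \<in> {w. x w \<noteq> 0}" using x by (simp add: W_def)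
    ultimately have "{w. x w \<noteq> 0} \<union> {w. \<iota> (\<rho> x) w \<noteq> 0} = {w. x w \<noteq> 0}"
      by (simp only: insert_Diff_single insert_absorb Un_absorb)
    then have R: "(\<lambda>w. (1 - t) * x w + t * \<iota> (\<rho> x) w) \<in> R"
      using seg[of x "\<iota> (\<rho> x)" t] x t i supp[of x] by (auto simp: U_def)
    have xv: "0 < x v" "x v < 1" using x by (auto simp: U_def W_def)
    have "0 < (1 - t) * x v + t * (1/2) \<and> (1 - t) * x v + t * (1/2) < 1"
    proof (cases "t = 1")
      case False
      then have "0 < (1 - t) * x v" "(1 - t) * x v < (1 - t) * 1"
        using t xv by (auto intro!: mult_strict_left_mono)
      then show ?thesis using t by auto
    qed auto
    then show "(\<lambda>w. (1 - t) * x w + t * \<iota> (\<rho> x) w) \<in> U \<inter> W" using R by (simp add: U_def W_def \<iota>_def)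
  qed (auto intro: c\<rho> c\<iota>)
  ultimately have "cube_connected n R"
    using cube_connected_open_Un[of U W n] by simp
  then show ?thesis by (simp add: R_def)
qed

section \<open>Homotopy groups\<close>

text \<open>\<open>f\<close> is transported radially to the boundary of the cube on
  \<open>i + 1\<close> coordinates and extended to \<open>G\<close>. As the cube is convex,
  \<open>G\<close> can be composed with the segments from the boundary points to the image of the
  base point; contracting there rather than to the center keeps the base point fixed
  throughout.\<close>

lemma homotopic_to_constant:
  fixes X :: "'a::topological_space set"
  assumes X: "cube_connected n X" and i: "int i \<le> n"
    and f: "continuous_map (nsphere i) (top_of_set X) f" "f sphere_base = a"
  shows "homotopic_with (\<lambda>h. h sphere_base = a) (nsphere i) (top_of_set X) f (\<lambda>_. a)"
proof -
  define J where "J = {..i}"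
  have J: "finite J" "int (card J) \<le> n + 1" using i by (auto simp: J_def)
  define S where "S = {x::nat \<Rightarrow> real. (\<Sum>j\<le>i. (x j)\<^sup>2) = 1 \<and> (\<forall>j>i. x j = 0)}"
  have sphere: "nsphere i = top_of_set S" by (simp add: nsphere S_def euclidean_product_topology)
  have f': "continuous_on S f" "f ` S \<subseteq> X" using f(1) by (auto simp: sphere)
  define N where "N x = sqrt (\<Sum>j\<le>i. (x j)\<^sup>2)" for x :: "nat \<Rightarrow> real"
  have Npos: "N x > 0" if "x j \<noteq> 0" "j \<le> i" for x j
    unfolding N_def using that by (auto intro!: sum_pos2[of _ j])
  have Nscale: "N (\<lambda>j. c * x j) = c * N x" if "c \<ge> 0" for c x
    using that by (simp add: N_def power_mult_distrib sum_distrib_left[symmetric] real_sqrt_mult)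
  define q where "q x = (\<lambda>j. x j / N x)" for x
  have qS: "q x \<in> S" if x: "x \<in> cube_boundary J" for x
  proof -
    obtain j where "j \<le> i" "\<bar>x j\<bar> = 1" using x by (auto simp: cube_boundary_def J_def)
    then have "N x > 0" using Npos[of x j] by auto
    then have "(\<Sum>j\<le>i. (x j)\<^sup>2) / (N x)\<^sup>2 = 1" by (simp add: N_def sum_nonneg)
    then show ?thesis using x
      by (auto simp: q_def S_def power_divide sum_divide_distrib[symmetric] cube_boundary_def cube_def J_def)
  qed
  have cq: "continuous_on (cube_boundary J) q"
    unfolding q_def N_def
  proof (intro continuous_intros)
    show "\<forall>x\<in>cube_boundary J. sqrt (\<Sum>j\<le>i. (x j)\<^sup>2) \<noteq> 0"
    proof
      fix x assume "x \<in> cube_boundary J"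
      then obtain j where "j \<le> i" "\<bar>x j\<bar> = 1" by (auto simp: cube_boundary_def J_def)
      then have "x j \<noteq> 0" by auto
      from Npos[of x j, OF this \<open>j \<le> i\<close>] show "sqrt (\<Sum>j\<le>i. (x j)\<^sup>2) \<noteq> 0" by (simp add: N_def)
    qed
  qed
  have "continuous_on (cube_boundary J) (\<lambda>x. f (q x))" "(\<lambda>x. f (q x)) ` cube_boundary J \<subseteq> X"
    using qS f'(2) by (auto intro!: continuous_on_compose2[OF f'(1) cq])
  then obtain G where G: "continuous_on (cube J) G" "G ` cube J \<subseteq> X"
    "\<And>x. x \<in> cube_boundary J \<Longrightarrow> G x = f (q x)"
    using cube_connectedD[OF X J, of "\<lambda>x. f (q x)"] by metis
  define p where "p x = (\<lambda>j. x j / cube_gauge J x)" for x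
  have gauge: "cube_gauge J x > 0" if x: "x \<in> S" for x
  proof -
    obtain j where "j \<le> i" "x j \<noteq> 0"
    proof (rule ccontr)
      assume "\<not> thesis"
      then have "\<forall>j\<le>i. x j = 0" using that by blast
      then have "(\<Sum>j\<le>i. (x j)\<^sup>2) = 0" by simp
      then show False using x by (simp add: S_def)
    qed
    then show ?thesis using cube_gauge_ge[OF J(1), of j x] by (auto simp: J_def)
  qed
  have pbd: "p x \<in> cube_boundary J" if x: "x \<in> S" for x
    unfolding p_def using x gauge[OF x]
    by (intro scale_cube_boundary[OF J(1)]) (auto simp: S_def J_def)
  have qp: "q (p x) = x" if x: "x \<in> S" for x
  proof -
    have "N x = 1" using x by (simp add: N_def S_def)
    then have "N (p x) = 1 / cube_gauge J x"
      using Nscale[of "1 / cube_gauge J x" x] gauge[OF x] by (simp add: p_def)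
    then show ?thesis using gauge[OF x] by (auto simp: q_def p_def)
  qed
  have cp: "continuous_on S p"
    unfolding p_def
    by (intro continuous_intros continuous_on_cube_gauge J(1) continuous_on_coord) (auto dest: gauge)
  have base: "sphere_base \<in> S"
    by (auto simp: S_def sphere_base_def if_distrib[of "\<lambda>x. x\<^sup>2"] cong: if_cong)
  define e where "e = (\<lambda>z::real \<times> (nat \<Rightarrow> real). \<lambda>j. (1 - fst z) * p (snd z) j + fst z * p sphere_base j)"
  have ecube: "e z \<in> cube J" if z: "z \<in> {0..1} \<times> S" for z
  proof -
    obtain t x where z': "z = (t, x)" "0 \<le> t" "t \<le> 1" "x \<in> S" using z by auto
    have *: "\<bar>(1 - t) * u + t * w\<bar> \<le> 1" if "\<bar>u\<bar> \<le> 1" "\<bar>w\<bar> \<le> 1" for u w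
    proof -
      have "\<bar>(1 - t) * u + t * w\<bar> \<le> (1 - t) * \<bar>u\<bar> + t * \<bar>w\<bar>"
        using z'(2,3) by (intro order_trans[OF abs_triangle_ineq]) (simp add: abs_mult)
      also have "\<dots> \<le> (1 - t) * 1 + t * 1"
        using z'(2,3) that by (intro add_mono mult_left_mono) auto
      finally show ?thesis by simp
    qed
    show ?thesis using pbd[OF z'(4)] pbd[OF base] *
      by (auto simp: z'(1) e_def cube_def cube_boundary_def)
  qed
  have ce: "continuous_on ({0..1} \<times> S) e"
  proof -
    have "continuous_on ({0..1::real} \<times> S) (\<lambda>z. p (snd z))"
      by (rule continuous_on_compose2[OF cp]) (auto intro: continuous_intros)
    then have 1: "continuous_on ({0..1::real} \<times> S) (\<lambda>z. p (snd z) j)" for j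
      by (rule continuous_on_product_then_coordinatewise)
    have 2: "continuous_on ({0..1::real} \<times> S) (\<lambda>z. fst z)" by (intro continuous_intros)
    show ?thesis unfolding e_def
      by (rule continuous_on_coordinatewise_then_product)
        (intro continuous_on_add continuous_on_mult continuous_on_diff continuous_on_const 1 2)
  qed
  have e0: "G (e (0, x)) = f x" if "x \<in> S" for x
    using G(3)[OF pbd[OF that]] qp[OF that] by (simp add: e_def)
  have e1: "G (e (1, x)) = a" for x
    using G(3)[OF pbd[OF base]] qp[OF base] f(2) by (simp add: e_def)
  have eb: "G (e (t, sphere_base)) = a" for t
  proof -
    have "e (t, sphere_base) = p sphere_base" by (auto simp: e_def algebra_simps)
    then show ?thesis using G(3)[OF pbd[OF base]] qp[OF base] f(2) by simp
  qed
  have cont: "continuous_on ({0..1} \<times> S) (\<lambda>z. G (e z))"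
    by (rule continuous_on_compose2[OF G(1) ce]) (use ecube in auto)
  have im: "(\<lambda>z. G (e z)) \<in> {0..1} \<times> S \<rightarrow> X" using ecube G(2) by auto
  have "homotopic_with (\<lambda>h. h sphere_base = a) (nsphere i) (top_of_set X) f (\<lambda>_. a) \<longleftrightarrow>
    (\<exists>h. continuous_map (prod_topology (top_of_set {0..1::real}) (nsphere i)) (top_of_set X) h \<and>
      (\<forall>x\<in>topspace (nsphere i). h (0, x) = f x) \<and> (\<forall>x\<in>topspace (nsphere i). h (1, x) = a) \<and>
      (\<forall>t\<in>{0..1}. h (t, sphere_base) = a))"
    by (rule homotopic_with) (simp add: sphere base)
  then show ?thesis
    using cont im e0 e1 eb by (auto simp: sphere intro!: exI[of _ "\<lambda>z. G (e z)"])
qed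

lemma n_connected_space_cube_connected:
  fixes X :: "'a::topological_space set"
  assumes X: "cube_connected n X"
  shows "n_connected_space n (top_of_set X)"
  unfolding n_connected_space_def
proof (intro conjI impI allI ballI)
  assume "-1 \<le> n"
  \<comment> \<open>The cube on no coordinates is a point with empty boundary, so the extension
    property yields a point of \<open>X\<close>.\<close>
  then have "int (card ({}::nat set)) \<le> n + 1" by simp
  moreover have "cube_boundary {} = {}" "cube {} \<noteq> {}" by (auto simp: cube_boundary_def cube_def)
  ultimately obtain F where "F ` cube {} \<subseteq> X" using cube_connectedD[OF X finite.emptyI] by (metis continuous_on_empty empty_subsetI image_empty)
  then show "topspace (top_of_set X) \<noteq> {}" using \<open>cube {} \<noteq> {}\<close> by auto
next
  fix i a assume i: "int i \<le> n" and a: "a \<in> topspace (top_of_set X)"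
  define R where "R = {(f, g). homotopic_with (\<lambda>h. h sphere_base = a) (nsphere i) (top_of_set X) f g}"
  define M where "M = {f. continuous_map (nsphere i) (top_of_set X) f \<and> f sphere_base = a}"
  have c: "(\<lambda>_. a) \<in> M" using a by (simp add: M_def)
  have cls: "R `` {f} = R `` {\<lambda>_. a}" if "f \<in> M" for f
  proof -
    have "homotopic_with (\<lambda>h. h sphere_base = a) (nsphere i) (top_of_set X) f (\<lambda>_. a)"
      using homotopic_to_constant[OF X i] that by (simp add: M_def)
    then show ?thesis
      by (auto simp: R_def intro: homotopic_with_trans homotopic_with_symD)
  qed
  have "M // R = (\<Union>f\<in>M. {R `` {\<lambda>_. a}})"
    unfolding quotient_def by (intro SUP_cong refl) (simp only: cls)
  then have "M // R = {R `` {\<lambda>_. a}}" using c by auto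
  then show "is_singleton (homotopy_group_set i (top_of_set X) a)"
    by (simp add: homotopy_group_set_def M_def R_def)
qed

section \<open>Unavoidable rainbow families\<close>

definition slot :: "(nat \<Rightarrow> nat) \<Rightarrow> (nat \<times> nat) set \<Rightarrow> nat \<Rightarrow> nat \<Rightarrow> nat set"
  where "slot col V i c = {a. (i, a) \<in> V \<and> col a = c}"

text \<open>A row counts only while it shares a vertex of color \<open>c\<close> with row
  \<open>i\<close>; once the two slots are disjoint, it can take nothing from row \<open>i\<close>
  in this color.\<close>

definition slot_rivals :: "(nat \<Rightarrow> nat) \<Rightarrow> (nat \<times> nat) set \<Rightarrow> nat \<Rightarrow> nat \<Rightarrow> nat set"
  where "slot_rivals col V i c = {j. j \<noteq> i \<and> slot col V i c \<inter> slot col V j c \<noteq> {}}"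

lemma row_insert: "insert (j, b) \<sigma> `` {i} = (if i = j then insert b (\<sigma> `` {j}) else \<sigma> `` {i})"
  by auto

section \<open>Colors and members of the family\<close>

locale rainbow_family =
  fixes r k m :: nat and s :: int
    and C :: "nat \<Rightarrow> nat set" and K :: "nat \<Rightarrow> nat set set"
  assumes coloring: "coloring m k C"
    and subcomplex: "\<And>i. i \<in> {1..r} \<Longrightarrow> subcomplex_of_simplex m (K i)"
    and unavoidable: "collectively_rainbow_unavoidable m k C r s K"
    and balanced: "\<And>i. i \<in> {1..r} \<Longrightarrow> rainbow_balanced m k C (K i)"
begin

definition col :: "nat \<Rightarrow> nat"
  where "col a = (SOME c. c \<in> {1..k+1} \<and> a \<in> C c)"

lemma col: 
  assumes "a \<in> {1..m}"
  shows "col a \<in> {1..k+1}" "a \<in> C (col a)"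
proof -
  have "\<exists>c. c \<in> {1..k+1} \<and> a \<in> C c" using assms coloring unfolding coloring_def by blast
  from someI_ex[OF this] show "col a \<in> {1..k+1}" "a \<in> C (col a)" by (simp_all add: col_def)
qed

lemma C_subset: "c \<in> {1..k+1} \<Longrightarrow> C c \<subseteq> {1..m}"
  using coloring unfolding coloring_def by blast

lemma col_eq:
  assumes "c \<in> {1..k+1}" "a \<in> C c"
  shows "col a = c"
proof (rule ccontr)
  assume n: "col a \<noteq> c"
  have a: "a \<in> {1..m}" using C_subset[OF assms(1)] assms(2) by (rule subsetD)
  have "disjoint_family_on C {1..k+1}" using coloring by (simp add: coloring_def)
  then have "C (col a) \<inter> C c = {}" using disjoint_family_onD col(1)[OF a] assms(1) n by metis
  then show False using col(2)[OF a] assms(2) by blast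
qed

lemma rainbow_iff:
  assumes X: "X \<subseteq> {1..m}"
  shows "rainbow k C X \<longleftrightarrow> inj_on col X"
proof
  have fin: "finite X" using X by (auto intro: finite_subset)
  assume R: "rainbow k C X"
  show "inj_on col X"
  proof (rule inj_onI)
    fix a b assume ab: "a \<in> X" "b \<in> X" "col a = col b"
    have "card (X \<inter> C (col a)) \<le> 1" using R col(1)[of a] ab(1) X by (auto simp: rainbow_def)
    moreover have "a \<in> X \<inter> C (col a)" "b \<in> X \<inter> C (col a)"
      using col(2)[of a] col(2)[of b] ab X by auto
    ultimately show "a = b" using fin by (metis card_le_Suc0_iff_eq finite_Int One_nat_def)
  qed
next
  have fin: "finite X" using X by (auto intro: finite_subset)
  assume I: "inj_on col X"
  show "rainbow k C X" unfolding rainbow_def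
  proof
    fix c assume c: "c \<in> {1..k+1}"
    have "a = b" if "a \<in> X \<inter> C c" "b \<in> X \<inter> C c" for a b
      using that col_eq[OF c] I by (metis IntD1 IntD2 inj_onD)
    then show "card (X \<inter> C c) \<le> 1" using fin by (simp add: card_le_Suc0_iff_eq)
  qed
qed

lemma K_downward: "i \<in> {1..r} \<Longrightarrow> A \<in> K i \<Longrightarrow> B \<subseteq> A \<Longrightarrow> B \<in> K i"
  using subcomplex unfolding subcomplex_of_simplex_def by blast

lemma K_rainbow:
  assumes "i \<in> {1..r}" "A \<in> K i"
  shows "A \<subseteq> {1..m}" "inj_on col A"
proof -
  have "A \<in> rainbow_skeleton m k C (int k)" using balanced assms unfolding rainbow_balanced_def by blast
  then show "A \<subseteq> {1..m}" "inj_on col A" using rainbow_iff[of A] by (simp_all add: rainbow_skeleton_def)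
qed

text \<open>The lower half of balancedness: a rainbow set of at most \<open>k\<close> elements may
  be given to any member of the family. All exchanges of members rest on this.\<close>

lemma K_small:
  assumes "i \<in> {1..r}" "A \<subseteq> {1..m}" "inj_on col A" "card A \<le> k"
  shows "A \<in> K i"
proof -
  have "A \<in> rainbow_skeleton m k C (int k - 1)"
    using assms rainbow_iff[of A] by (simp add: rainbow_skeleton_def)
  then show ?thesis using balanced assms unfolding rainbow_balanced_def by blast
qed

text \<open>The leftover set \<open>B\<close> takes the vertices outside all \<open>X i\<close>; the
  \<open>s\<close> indices then inject into the set counted here.\<close>

lemma unavoidable_card:
  assumes X: "\<And>i. i \<in> {1..r} \<Longrightarrow> X i \<subseteq> {1..m}" "\<And>i. i \<in> {1..r} \<Longrightarrow> inj_on col (X i)"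
    and disj: "disjoint_family_on X {1..r}"
  shows "s \<le> int (card {i \<in> {1..r}. X i \<in> K i})"
proof (cases "s \<ge> 0")
  case True
  have "rainbow_partition m k C r X ({1..m} - (\<Union>i\<in>{1..r}. X i))"
    unfolding rainbow_partition_def
  proof (intro conjI ballI disj)
    show "(\<Union>i\<in>{1..r}. X i) \<union> ({1..m} - (\<Union>i\<in>{1..r}. X i)) = {1..m}" using X(1) by blast
    show "rainbow k C (X i)" if "i \<in> {1..r}" for i using rainbow_iff X that by blast
  qed blast
  with unavoidable have "\<exists>idx :: int \<Rightarrow> nat. inj_on idx {1..s} \<and>
    (\<forall>j\<in>{1..s}. idx j \<in> {1..r} \<and> X (idx j) \<in> K (idx j))"
    unfolding collectively_rainbow_unavoidable_def by metis
  then obtain idx :: "int \<Rightarrow> nat" where idx: "inj_on idx {1..s}"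
    "\<forall>j\<in>{1..s}. idx j \<in> {1..r} \<and> X (idx j) \<in> K (idx j)"
    by blast
  have "card {1..s} \<le> card {i \<in> {1..r}. X i \<in> K i}"
    using idx by (intro card_inj_on_le[of idx]) auto
  then show ?thesis using True by simp
qed simp

section \<open>Simplices of the symmetrized deleted join\<close>

abbreviation S :: "(nat \<times> nat) set set"
  where "S \<equiv> symm_deleted_join r K"

text \<open>A simplex is read as a relation between rows and vertices: its components are the row
  images, and disjointness says that no vertex occurs in two rows.\<close>

lemma mem_S_iff:
  "\<tau> \<in> S \<longleftrightarrow> \<tau> \<subseteq> {1..r} \<times> {1..m} \<and> (\<forall>i j a. (i, a) \<in> \<tau> \<longrightarrow> (j, a) \<in> \<tau> \<longrightarrow> i = j) \<and>
    (\<exists>\<pi>. \<pi> permutes {1..r} \<and> (\<forall>i\<in>{1..r}. \<tau> `` {i} \<in> K (\<pi> i)))"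
proof
  assume "\<tau> \<in> S"
  then obtain \<pi> A where \<pi>: "\<pi> permutes {1..r}" and \<tau>: "\<tau> = Sigma {1..r} A"
    and A: "\<forall>i\<in>{1..r}. A i \<in> K (\<pi> i)" and disj: "disjoint_family_on A {1..r}"
    unfolding symm_deleted_join_def deleted_join_def by blast
  have img: "\<tau> `` {i} = A i" if "i \<in> {1..r}" for i using that by (auto simp: \<tau>)
  have "A i \<subseteq> {1..m}" if "i \<in> {1..r}" for i
    using K_rainbow(1)[of "\<pi> i" "A i"] A that permutes_in_image[OF \<pi>, of i] by blast
  then have "\<tau> \<subseteq> {1..r} \<times> {1..m}" unfolding \<tau> by blast
  moreover have "i = j" if "(i, a) \<in> \<tau>" "(j, a) \<in> \<tau>" for i j a
    using that disj unfolding \<tau> by (auto dest: disjoint_family_onD)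
  moreover have "\<exists>\<pi>. \<pi> permutes {1..r} \<and> (\<forall>i\<in>{1..r}. \<tau> `` {i} \<in> K (\<pi> i))"
    using \<pi> A img by (intro exI[of _ \<pi>]) simp
  ultimately show "\<tau> \<subseteq> {1..r} \<times> {1..m} \<and> (\<forall>i j a. (i, a) \<in> \<tau> \<longrightarrow> (j, a) \<in> \<tau> \<longrightarrow> i = j) \<and>
    (\<exists>\<pi>. \<pi> permutes {1..r} \<and> (\<forall>i\<in>{1..r}. \<tau> `` {i} \<in> K (\<pi> i)))"
    by blast
next
  assume R: "\<tau> \<subseteq> {1..r} \<times> {1..m} \<and> (\<forall>i j a. (i, a) \<in> \<tau> \<longrightarrow> (j, a) \<in> \<tau> \<longrightarrow> i = j) \<and>
    (\<exists>\<pi>. \<pi> permutes {1..r} \<and> (\<forall>i\<in>{1..r}. \<tau> `` {i} \<in> K (\<pi> i)))"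
  note \<tau> = conjunct1[OF R] conjunct1[OF conjunct2[OF R]]
  from conjunct2[OF conjunct2[OF R]] obtain \<pi> where \<pi>: "\<pi> permutes {1..r}" "\<forall>i\<in>{1..r}. \<tau> `` {i} \<in> K (\<pi> i)" by blast
  have "\<tau> = Sigma {1..r} (\<lambda>i. \<tau> `` {i})" using \<tau>(1) by blast
  moreover have "disjoint_family_on (\<lambda>i. \<tau> `` {i}) {1..r}"
    using \<tau>(2) unfolding disjoint_family_on_def by blast
  ultimately have "\<tau> \<in> deleted_join r (\<lambda>i. K (\<pi> i))"
    using \<pi>(2) unfolding deleted_join_def by blast
  then show "\<tau> \<in> S" using \<pi>(1) unfolding symm_deleted_join_def by blast
qed

lemma S_rows:
  assumes "\<tau> \<in> S"
  shows "\<exists>\<pi>. \<pi> permutes {1..r} \<and> (\<forall>i\<in>{1..r}. \<pi> i \<in> {1..r} \<and> \<tau> `` {i} \<in> K (\<pi> i))"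
proof -
  have "\<exists>\<pi>. \<pi> permutes {1..r} \<and> (\<forall>i\<in>{1..r}. \<tau> `` {i} \<in> K (\<pi> i))"
    using assms[unfolded mem_S_iff] by (elim conjE)
  then obtain \<pi> where \<pi>: "\<pi> permutes {1..r}" "\<forall>i\<in>{1..r}. \<tau> `` {i} \<in> K (\<pi> i)" by blast
  have "\<pi> i \<in> {1..r}" if "i \<in> {1..r}" for i using that permutes_in_image[OF \<pi>(1)] by simp
  then show ?thesis using \<pi> by (intro exI[of _ \<pi>]) simp
qed

lemma S_intro:
  assumes "\<tau> \<subseteq> {1..r} \<times> {1..m}" "\<And>i j a. (i, a) \<in> \<tau> \<Longrightarrow> (j, a) \<in> \<tau> \<Longrightarrow> i = j"
    "\<pi> permutes {1..r}" "\<And>i. i \<in> {1..r} \<Longrightarrow> \<tau> `` {i} \<in> K (\<pi> i)"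
  shows "\<tau> \<in> S"
  unfolding mem_S_iff
proof (intro conjI exI[of _ \<pi>] allI impI ballI)
  show "\<tau> \<subseteq> {1..r} \<times> {1..m}" "\<pi> permutes {1..r}" by fact+
  show "i = j" if "(i, a) \<in> \<tau>" "(j, a) \<in> \<tau>" for i j a using assms(2)[OF that] .
  show "\<tau> `` {i} \<in> K (\<pi> i)" if "i \<in> {1..r}" for i using assms(4)[OF that] .
qed

lemma S_subset: "\<tau> \<in> S \<Longrightarrow> \<tau> \<subseteq> {1..r} \<times> {1..m}"
  by (simp add: mem_S_iff)

lemma S_column: "\<tau> \<in> S \<Longrightarrow> (i, a) \<in> \<tau> \<Longrightarrow> (j, a) \<in> \<tau> \<Longrightarrow> i = j"
  unfolding mem_S_iff by blast

lemma S_downward: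
  assumes "\<tau> \<in> S" "\<tau>' \<subseteq> \<tau>"
  shows "\<tau>' \<in> S"
proof -
  obtain \<pi> where \<pi>: "\<pi> permutes {1..r}" "\<And>i. i \<in> {1..r} \<Longrightarrow> \<pi> i \<in> {1..r}"
    "\<And>i. i \<in> {1..r} \<Longrightarrow> \<tau> `` {i} \<in> K (\<pi> i)"
    using S_rows[OF assms(1)] by blast
  show ?thesis
  proof (rule S_intro[OF _ _ \<pi>(1)])
    show "\<tau>' \<subseteq> {1..r} \<times> {1..m}" using assms(2) S_subset[OF assms(1)] by (rule order_trans)
    show "i = j" if "(i, a) \<in> \<tau>'" "(j, a) \<in> \<tau>'" for i j a
      using S_column[OF assms(1)] assms(2) that by blast
    show "\<tau>' `` {i} \<in> K (\<pi> i)" if "i \<in> {1..r}" for i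
      by (rule K_downward[OF \<pi>(2)[OF that] \<pi>(3)[OF that]]) (use assms(2) in blast)
  qed
qed

lemma S_finite: "\<tau> \<in> S \<Longrightarrow> finite \<tau>"
  by (rule finite_subset[OF S_subset]) auto

lemma S_row:
  assumes "\<tau> \<in> S"
  shows "inj_on col (\<tau> `` {i})"
proof (cases "i \<in> {1..r}")
  case True
  obtain \<pi> where "\<pi> permutes {1..r}" and \<pi>: "\<And>i. i \<in> {1..r} \<Longrightarrow> \<pi> i \<in> {1..r}"
    "\<And>i. i \<in> {1..r} \<Longrightarrow> \<tau> `` {i} \<in> K (\<pi> i)"
    using S_rows[OF assms] by blast
  show ?thesis by (rule K_rainbow(2)[OF \<pi>[OF True]])
next
  case False
  then have "\<tau> `` {i} = {}" using S_subset[OF assms] by blast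
  then show ?thesis by simp
qed

text \<open>The enlarged row has at most \<open>k\<close> elements, so the member matched with it
  accepts it and the matching stays.\<close>

lemma S_insert:
  assumes \<tau>: "\<tau> \<in> S" and j: "j \<in> {1..r}" and a: "a \<in> {1..m}" "\<And>i. (i, a) \<notin> \<tau>"
    and inj: "inj_on col (insert a (\<tau> `` {j}))" and card: "card (insert a (\<tau> `` {j})) \<le> k"
  shows "insert (j, a) \<tau> \<in> S"
proof -
  obtain \<pi> where \<pi>: "\<pi> permutes {1..r}" "\<And>i. i \<in> {1..r} \<Longrightarrow> \<pi> i \<in> {1..r}"
    "\<And>i. i \<in> {1..r} \<Longrightarrow> \<tau> `` {i} \<in> K (\<pi> i)"
    using S_rows[OF \<tau>] by blast
  have "insert a (\<tau> `` {j}) \<subseteq> {1..m}" using S_subset[OF \<tau>] a(1) by blast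
  then have new: "insert a (\<tau> `` {j}) \<in> K (\<pi> j)" using K_small[OF \<pi>(2)[OF j]] inj card by blast
  show ?thesis
  proof (rule S_intro[OF _ _ \<pi>(1)])
    show "insert (j, a) \<tau> \<subseteq> {1..r} \<times> {1..m}" using S_subset[OF \<tau>] j a(1) by blast
    show "i = i'" if "(i, x) \<in> insert (j, a) \<tau>" "(i', x) \<in> insert (j, a) \<tau>" for i i' x
      using S_column[OF \<tau>] a(2) that by blast
    show "insert (j, a) \<tau> `` {i} \<in> K (\<pi> i)" if "i \<in> {1..r}" for i
      using new \<pi>(3)[OF that] by (simp add: row_insert)
  qed
qed

text \<open>When \<open>V\<close> avoids \<open>\<sigma>\<close>, as it does in admissible
  situations, this is the link of \<open>\<sigma>\<close> in \<open>S\<close> induced on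
  \<open>V\<close>. Links and deletions of vertices then again have this form.\<close>

definition link_on :: "(nat \<times> nat) set \<Rightarrow> (nat \<times> nat) set \<Rightarrow> (nat \<times> nat) set set"
  where "link_on \<sigma> V = {\<tau>. \<tau> \<subseteq> V \<and> \<tau> \<union> \<sigma> \<in> S}"

lemma link_on_downward: "A \<in> link_on \<sigma> V \<Longrightarrow> B \<subseteq> A \<Longrightarrow> B \<in> link_on \<sigma> V"
  using S_downward[of "A \<union> \<sigma>" "B \<union> \<sigma>"] unfolding link_on_def by blast

lemma link_on_Pow: "link_on \<sigma> V \<subseteq> Pow V"
  by (auto simp: link_on_def)

text \<open>The vertices of \<open>D\<close> are put back one at a time by
  \<open>cube_connected_vertex\<close>. The set \<open>W\<close> stands for what is present just
  before \<open>v\<close>; allowing any such \<open>W\<close> leaves the order open.\<close>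

lemma cube_connected_add_vertices:
  assumes V: "finite V" and D: "D \<subseteq> V"
    and del: "cube_connected n (realization (link_on \<sigma> (V - D)))"
    and lnk: "\<And>v W. v \<in> D \<Longrightarrow> V - D \<subseteq> W \<Longrightarrow> W \<subseteq> V - {v} \<Longrightarrow> insert v \<sigma> \<in> S \<Longrightarrow>
      cube_connected (n - 1) (realization {\<tau>. \<tau> \<subseteq> W \<and> insert v (\<tau> \<union> \<sigma>) \<in> S})"
  shows "cube_connected n (realization (link_on \<sigma> V))"
proof -
  have "finite D" using V D by (rule rev_finite_subset)
  moreover have "cube_connected n (realization (link_on \<sigma> ((V - D) \<union> F)))" if "finite F" "F \<subseteq> D" for F
    using that
  proof (induction F rule: finite_induct)
    case empty
    then show ?case using del by simp
  next
    case (insert v F)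
    define W where "W = (V - D) \<union> F"
    have W: "V - D \<subseteq> W" "W \<subseteq> V - {v}" "v \<notin> W" using insert.prems insert.hyps D by (auto simp: W_def)
    have eq: "(V - D) \<union> insert v F = insert v W" by (auto simp: W_def)
    have "F \<subseteq> D" using insert.prems by simp
    show ?case unfolding eq
    proof (rule cube_connected_vertex[where v = v and V = "insert v W"])
      show "finite (insert v W)" using finite_subset[OF W(2)] V by simp
      show "link_on \<sigma> (insert v W) \<subseteq> Pow (insert v W)" by (rule link_on_Pow)
      show "B \<in> link_on \<sigma> (insert v W)" if "A \<in> link_on \<sigma> (insert v W)" "B \<subseteq> A" for A B
        using that by (rule link_on_downward)
      have "{A \<in> link_on \<sigma> (insert v W). v \<notin> A} = link_on \<sigma> W"
        using W(3) by (auto simp: link_on_def)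
      then show "cube_connected n (realization {A \<in> link_on \<sigma> (insert v W). v \<notin> A})"
        using insert.IH[OF \<open>F \<subseteq> D\<close>] by (simp add: W_def)
      assume "{v} \<in> link_on \<sigma> (insert v W)"
      then have "insert v \<sigma> \<in> S" by (simp add: link_on_def)
      moreover have "{A. v \<notin> A \<and> insert v A \<in> link_on \<sigma> (insert v W)} = {\<tau>. \<tau> \<subseteq> W \<and> insert v (\<tau> \<union> \<sigma>) \<in> S}"
        using W(3) by (auto simp: link_on_def)
      ultimately show "cube_connected (n - 1) (realization {A. v \<notin> A \<and> insert v A \<in> link_on \<sigma> (insert v W)})"
        using lnk[of v W] insert.prems W by simp
    qed
  qed
  moreover have "(V - D) \<union> D = V" using D by blast
  ultimately show ?thesis using subset_refl by metis
qed

text \<open>Beside \<open>(j, b)\<close>, a simplex has no other vertex in column \<open>b\<close>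
  and no other vertex of that color in row \<open>j\<close>. So the link does not depend on which of
  these \<open>W\<close> contains, and one \<open>V'\<close> serves every stage of putting vertices
  back.\<close>

lemma link_on_insert_eq:
  assumes "V' \<subseteq> W" "(j, b) \<notin> W"
    and "\<And>i x. (i, x) \<in> W - V' \<Longrightarrow> x = b \<or> i = j \<and> col x = col b"
  shows "{\<tau>. \<tau> \<subseteq> W \<and> insert (j, b) (\<tau> \<union> \<sigma>) \<in> S} = link_on (insert (j, b) \<sigma>) V'"
proof -
  have "\<tau> \<subseteq> V'" if \<tau>: "\<tau> \<subseteq> W" "insert (j, b) (\<tau> \<union> \<sigma>) \<in> S" for \<tau>
  proof (rule subrelI, rule ccontr)
    fix i x assume ix: "(i, x) \<in> \<tau>" "(i, x) \<notin> V'"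
    then have "x = b \<or> i = j \<and> col x = col b" using assms(3)[of i x] \<tau>(1) by blast
    moreover have "x = b" if "i = j" "col x = col b"
    proof (rule inj_onD[OF S_row[OF \<tau>(2), of j] that(2)])
      show "x \<in> insert (j, b) (\<tau> \<union> \<sigma>) `` {j}" "b \<in> insert (j, b) (\<tau> \<union> \<sigma>) `` {j}"
        using ix(1) that(1) by auto
    qed
    ultimately have "x = b" by blast
    then have "i = j" using S_column[OF \<tau>(2), of i b j] ix(1) by auto
    then show False using \<open>x = b\<close> ix(1) \<tau>(1) assms(2) by blast
  qed
  then show ?thesis using assms(1) by (auto simp: link_on_def)
qed

text \<open>The complexes of the induction are links of a simplex \<open>\<sigma>\<close>, restricted to a set \<open>V\<close> of vertices.
  A row \<open>i\<close> in which \<open>\<eta>\<close> exceeds \<open>\<sigma>\<close> is abandoned: it has no vertex left, but one vertex is missing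
  from it, and the full rainbow set that this vertex would complete is not in \<open>K (\<beta> i)\<close>. In each color
  still open in a row that is not abandoned, there is enough room for the vertices which other
  rows may take away.\<close>

definition admissible ::
    "(nat \<times> nat) set \<Rightarrow> (nat \<times> nat) set \<Rightarrow> (nat \<Rightarrow> nat) \<Rightarrow> (nat \<times> nat) set \<Rightarrow> bool"
  where "admissible \<sigma> \<eta> \<beta> V \<longleftrightarrow>
    \<sigma> \<in> S \<and> \<sigma> \<subseteq> \<eta> \<and> \<eta> \<subseteq> {1..r} \<times> {1..m} \<and> V \<subseteq> {1..r} \<times> {1..m} \<and>
    (\<forall>i j a. (i, a) \<in> \<eta> \<longrightarrow> (j, a) \<in> \<eta> \<longrightarrow> i = j) \<and>
    (\<forall>i. inj_on col (\<eta> `` {i})) \<and>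
    (\<forall>i j a. (i, a) \<in> V \<longrightarrow> (j, a) \<notin> \<eta>) \<and>
    (\<forall>i a b. (i, a) \<in> V \<longrightarrow> (i, b) \<in> \<eta> \<longrightarrow> col a \<noteq> col b) \<and>
    inj_on \<beta> {i. \<eta> `` {i} \<noteq> \<sigma> `` {i}} \<and>
    (\<forall>i. \<eta> `` {i} \<noteq> \<sigma> `` {i} \<longrightarrow>
      \<beta> i \<in> {1..r} \<and> \<eta> `` {i} \<notin> K (\<beta> i) \<and> card (\<sigma> `` {i}) = k \<and> V `` {i} = {}) \<and>
    (\<forall>i\<in>{1..r}. \<forall>c\<in>{1..k+1}. \<eta> `` {i} = \<sigma> `` {i} \<longrightarrow> c \<notin> col ` (\<eta> `` {i}) \<longrightarrow>
      2 * card (slot_rivals col V i c) + 1 \<le> card (slot col V i c))"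

section \<open>Stability of admissible configurations\<close>

lemma admissibleD:
  assumes "admissible \<sigma> \<eta> \<beta> V"
  shows "\<sigma> \<in> S" "\<sigma> \<subseteq> \<eta>" "\<eta> \<subseteq> {1..r} \<times> {1..m}" "V \<subseteq> {1..r} \<times> {1..m}"
    "\<And>i j a. (i, a) \<in> \<eta> \<Longrightarrow> (j, a) \<in> \<eta> \<Longrightarrow> i = j"
    "\<And>i. inj_on col (\<eta> `` {i})"
    "\<And>i j a. (i, a) \<in> V \<Longrightarrow> (j, a) \<notin> \<eta>"
    "\<And>i a b. (i, a) \<in> V \<Longrightarrow> (i, b) \<in> \<eta> \<Longrightarrow> col a \<noteq> col b"
    "inj_on \<beta> {i. \<eta> `` {i} \<noteq> \<sigma> `` {i}}"
    "\<And>i. \<eta> `` {i} \<noteq> \<sigma> `` {i} \<Longrightarrow> 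
      \<beta> i \<in> {1..r} \<and> \<eta> `` {i} \<notin> K (\<beta> i) \<and> card (\<sigma> `` {i}) = k \<and> V `` {i} = {}"
    "\<And>i c. i \<in> {1..r} \<Longrightarrow> c \<in> {1..k+1} \<Longrightarrow> \<eta> `` {i} = \<sigma> `` {i} \<Longrightarrow> c \<notin> col ` (\<eta> `` {i}) \<Longrightarrow>
      2 * card (slot_rivals col V i c) + 1 \<le> card (slot col V i c)"
  using assms unfolding admissible_def by (elim conjE, blast)+

lemma admissibleI:
  assumes "\<sigma> \<in> S" "\<sigma> \<subseteq> \<eta>" "\<eta> \<subseteq> {1..r} \<times> {1..m}" "V \<subseteq> {1..r} \<times> {1..m}"
    "\<And>i j a. (i, a) \<in> \<eta> \<Longrightarrow> (j, a) \<in> \<eta> \<Longrightarrow> i = j"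
    "\<And>i. inj_on col (\<eta> `` {i})"
    "\<And>i j a. (i, a) \<in> V \<Longrightarrow> (j, a) \<notin> \<eta>"
    "\<And>i a b. (i, a) \<in> V \<Longrightarrow> (i, b) \<in> \<eta> \<Longrightarrow> col a \<noteq> col b"
    "inj_on \<beta> {i. \<eta> `` {i} \<noteq> \<sigma> `` {i}}"
    "\<And>i. \<eta> `` {i} \<noteq> \<sigma> `` {i} \<Longrightarrow> 
      \<beta> i \<in> {1..r} \<and> \<eta> `` {i} \<notin> K (\<beta> i) \<and> card (\<sigma> `` {i}) = k \<and> V `` {i} = {}"
    "\<And>i c. i \<in> {1..r} \<Longrightarrow> c \<in> {1..k+1} \<Longrightarrow> \<eta> `` {i} = \<sigma> `` {i} \<Longrightarrow> c \<notin> col ` (\<eta> `` {i}) \<Longrightarrow>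
      2 * card (slot_rivals col V i c) + 1 \<le> card (slot col V i c)"
  shows "admissible \<sigma> \<eta> \<beta> V"
  unfolding admissible_def
proof (intro conjI assms(1-4,9))
  show "\<forall>i j a. (i, a) \<in> \<eta> \<longrightarrow> (j, a) \<in> \<eta> \<longrightarrow> i = j" using assms(5) by blast
  show "\<forall>i. inj_on col (\<eta> `` {i})" using assms(6) by blast
  show "\<forall>i j a. (i, a) \<in> V \<longrightarrow> (j, a) \<notin> \<eta>" using assms(7) by blast
  show "\<forall>i a b. (i, a) \<in> V \<longrightarrow> (i, b) \<in> \<eta> \<longrightarrow> col a \<noteq> col b" using assms(8) by blast
  show "\<forall>i. \<eta> `` {i} \<noteq> \<sigma> `` {i} \<longrightarrow>
      \<beta> i \<in> {1..r} \<and> \<eta> `` {i} \<notin> K (\<beta> i) \<and> card (\<sigma> `` {i}) = k \<and> V `` {i} = {}"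
    by (intro allI impI assms(10))
  show "\<forall>i\<in>{1..r}. \<forall>c\<in>{1..k+1}. \<eta> `` {i} = \<sigma> `` {i} \<longrightarrow> c \<notin> col ` (\<eta> `` {i}) \<longrightarrow>
      2 * card (slot_rivals col V i c) + 1 \<le> card (slot col V i c)"
    by (intro ballI impI assms(11))
qed

text \<open>Among the clauses of \<open>admissible\<close>, only the room condition can fail when
  vertices are deleted, so it is the one to be checked anew.\<close>

lemma admissible_subset:
  assumes A: "admissible \<sigma> \<eta> \<beta> V" and "V' \<subseteq> V"
    and "\<And>i c. i \<in> {1..r} \<Longrightarrow> c \<in> {1..k+1} \<Longrightarrow> \<eta> `` {i} = \<sigma> `` {i} \<Longrightarrow> c \<notin> col ` (\<eta> `` {i}) \<Longrightarrow>
      2 * card (slot_rivals col V' i c) + 1 \<le> card (slot col V' i c)"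
  shows "admissible \<sigma> \<eta> \<beta> V'"
proof -
  note D = admissibleD[OF A]
  show ?thesis
  proof (rule admissibleI[OF D(1-3) _ D(5,6) _ _ D(9) _ assms(3)])
    show "V' \<subseteq> {1..r} \<times> {1..m}" using assms(2) D(4) by (rule order_trans)
    show "(j, a) \<notin> \<eta>" if "(i, a) \<in> V'" for i j a using D(7) that assms(2) by blast
    show "col a \<noteq> col b" if "(i, a) \<in> V'" "(i, b) \<in> \<eta>" for i a b using D(8) that assms(2) by blast
    show "\<beta> i \<in> {1..r} \<and> \<eta> `` {i} \<notin> K (\<beta> i) \<and> card (\<sigma> `` {i}) = k \<and> V' `` {i} = {}"
      if "\<eta> `` {i} \<noteq> \<sigma> `` {i}" for i
    proof -
      have "V' `` {i} = {}" using D(10)[OF that] assms(2) by blast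
      then show ?thesis using D(10)[OF that] by simp
    qed
  qed
qed

lemma finite_slot_rivals:
  assumes "V \<subseteq> {1..r} \<times> {1..m}"
  shows "finite (slot col V i c)" "finite (slot_rivals col V i c)"
proof -
  have "slot col V i c \<subseteq> {1..m}" "slot_rivals col V i c \<subseteq> {1..r}"
    using assms by (auto simp: slot_def slot_rivals_def)
  then show "finite (slot col V i c)" "finite (slot_rivals col V i c)"
    by (auto intro: finite_subset)
qed

text \<open>This is where the factor 2 comes from: with its rival \<open>j\<close>, a slot can lose two vertices.\<close>

lemma slot_room:
  assumes V: "V \<subseteq> {1..r} \<times> {1..m}" "V' \<subseteq> V" and ij: "i \<noteq> j"
    and room: "2 * card (slot_rivals col V i c) + 1 \<le> card (slot col V i c)"
    and lost: "slot col V i c - {a, b} \<subseteq> slot col V' i c"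
    and ab: "a \<in> slot col V j c" "b \<in> slot col V j c"
    and rival: "slot col V' i c \<inter> slot col V' j c = {}"
  shows "2 * card (slot_rivals col V' i c) + 1 \<le> card (slot col V' i c)"
proof -
  note fin = finite_slot_rivals[OF V(1)]
  have mono: "slot col V' i' c \<subseteq> slot col V i' c" for i' using V(2) by (auto simp: slot_def)
  then have riv: "slot_rivals col V' i c \<subseteq> slot_rivals col V i c - {j}"
    using rival unfolding slot_rivals_def by blast
  show ?thesis
  \<comment> \<open>If \<open>a\<close> or \<open>b\<close> was available to row \<open>i\<close>,
    then row \<open>j\<close> was a rival, and it is none any more: the left side of the bound drops
    by at least 2, the right side by at most 2.\<close>
  proof (cases "a \<in> slot col V i c \<or> b \<in> slot col V i c")
    case True
    then have "j \<in> slot_rivals col V i c" using ab ij by (auto simp: slot_rivals_def)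
    then have "card (slot_rivals col V' i c) + 1 \<le> card (slot_rivals col V i c)"
      using card_mono[OF _ riv] fin(2)[of i c]
      by (metis Suc_eq_plus1 card.remove finite_Diff not_less_eq_eq)
    moreover have "card (slot col V i c) \<le> card (slot col V i c - {a, b}) + 2"
    proof -
      have "card (slot col V i c) - card {a, b} \<le> card (slot col V i c - {a, b})"
        by (rule diff_card_le_card_Diff) simp
      moreover have "card {a, b} \<le> 2" by (cases "a = b") auto
      ultimately show ?thesis by linarith
    qed
    moreover have "card (slot col V i c - {a, b}) \<le> card (slot col V' i c)"
      using lost finite_subset[OF mono fin(1)] by (rule card_mono[rotated])
    ultimately show ?thesis using room by linarith
  next
    case False
    then have "slot col V' i c = slot col V i c" using lost mono[of i] by blast
    moreover have "card (slot_rivals col V' i c) \<le> card (slot_rivals col V i c)"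
      using riv fin(2) by (intro card_mono) auto
    ultimately show ?thesis using room by simp
  qed
qed

lemma slot_room_other_color:
  assumes "\<And>i' x. (i', x) \<in> V \<Longrightarrow> col x = c \<Longrightarrow> (i', x) \<in> V'" "V' \<subseteq> V"
  shows "slot col V' i c = slot col V i c" "slot_rivals col V' i c = slot_rivals col V i c"
proof -
  have eq: "slot col V' i c = slot col V i c" for i using assms by (auto simp: slot_def)
  then show "slot col V' i c = slot col V i c" "slot_rivals col V' i c = slot_rivals col V i c"
    by (auto simp: slot_rivals_def)
qed

text \<open>As \<open>b\<close> joins row \<open>j\<close>, column \<open>b\<close> and the color of
  \<open>b\<close> in row \<open>j\<close> go. Column \<open>a\<close> goes as well because the link
  may be taken where only row \<open>j\<close> still offers \<open>a\<close>; the case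
  \<open>a = b\<close> is the plain link. Any other slot of this color loses at most
  \<open>a\<close> and \<open>b\<close>, and \<open>j\<close> stops being its rival; other colors
  are untouched.\<close>

lemma admissible_link:
  assumes A: "admissible \<sigma> \<eta> \<beta> V" and a: "(j, a) \<in> V" and b: "(j, b) \<in> V" and ab: "col a = col b"
    and S: "insert (j, b) \<sigma> \<in> S"
  shows "admissible (insert (j, b) \<sigma>) (insert (j, b) \<eta>) \<beta>
    {(i, x) \<in> V. x \<noteq> a \<and> x \<noteq> b \<and> \<not> (i = j \<and> col x = col b)}" (is "admissible _ _ _ ?V'")
proof -
  note D = admissibleD[OF A]
  have V'V: "?V' \<subseteq> V" by auto
  have rj: "\<eta> `` {j} = \<sigma> `` {j}" using D(10)[of j] b by blast
  have bb: "j \<in> {1..r}" "b \<in> {1..m}" using D(4) b by auto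
  have ab_row: "insert (j, b) \<eta> `` {i} \<noteq> insert (j, b) \<sigma> `` {i} \<longleftrightarrow> \<eta> `` {i} \<noteq> \<sigma> `` {i}" for i
    using rj by (simp only: row_insert split: if_split) blast
  show ?thesis
  proof (rule admissibleI[OF S])
    show "insert (j, b) \<sigma> \<subseteq> insert (j, b) \<eta>" "insert (j, b) \<eta> \<subseteq> {1..r} \<times> {1..m}"
      using D(2,3) bb by auto
    show "?V' \<subseteq> {1..r} \<times> {1..m}" using V'V D(4) by (rule order_trans)
    show "i = i'" if "(i, x) \<in> insert (j, b) \<eta>" "(i', x) \<in> insert (j, b) \<eta>" for i i' x
      using that D(5) D(7)[OF b] by blast
    show "inj_on col (insert (j, b) \<eta> `` {i})" for i
      using D(6)[of i] D(8)[OF b] by (auto simp: row_insert inj_on_insert)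
    show "(i', x) \<notin> insert (j, b) \<eta>" if "(i, x) \<in> ?V'" for i i' x using that D(7) by blast
    show "col x \<noteq> col y" if "(i, x) \<in> ?V'" "(i, y) \<in> insert (j, b) \<eta>" for i x y
      using that D(8) by blast
    show "inj_on \<beta> {i. insert (j, b) \<eta> `` {i} \<noteq> insert (j, b) \<sigma> `` {i}}"
      unfolding ab_row by (rule D(9))
  next
    fix i assume "insert (j, b) \<eta> `` {i} \<noteq> insert (j, b) \<sigma> `` {i}"
    then have i: "\<eta> `` {i} \<noteq> \<sigma> `` {i}" unfolding ab_row .
    then have "i \<noteq> j" using rj by blast
    then have "insert (j, b) \<eta> `` {i} = \<eta> `` {i}" "insert (j, b) \<sigma> `` {i} = \<sigma> `` {i}"
      by (simp_all add: row_insert)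
    moreover have "?V' `` {i} = {}" using D(10)[OF i] V'V by blast
    ultimately show "\<beta> i \<in> {1..r} \<and> insert (j, b) \<eta> `` {i} \<notin> K (\<beta> i) \<and>
      card (insert (j, b) \<sigma> `` {i}) = k \<and> ?V' `` {i} = {}" using D(10)[OF i] by metis
  next
    fix i c assume i: "i \<in> {1..r}" and c: "c \<in> {1..k+1}"
      and "insert (j, b) \<eta> `` {i} = insert (j, b) \<sigma> `` {i}"
      and open_c: "c \<notin> col ` (insert (j, b) \<eta> `` {i})"
    then have row: "\<eta> `` {i} = \<sigma> `` {i}" using ab_row by blast
    have "c \<notin> col ` (\<eta> `` {i})" using open_c by blast
    note room = D(11)[OF i c row this]
    show "2 * card (slot_rivals col ?V' i c) + 1 \<le> card (slot col ?V' i c)"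
    proof (cases "c = col b")
      case True
      then have ij: "i \<noteq> j" using open_c by blast
      show ?thesis
      proof (rule slot_room[OF D(4) V'V ij room])
        show "slot col V i c - {a, b} \<subseteq> slot col ?V' i c" using ij by (auto simp: slot_def)
        show "a \<in> slot col V j c" "b \<in> slot col V j c" using a b ab True by (auto simp: slot_def)
        show "slot col ?V' i c \<inter> slot col ?V' j c = {}" using True by (auto simp: slot_def)
      qed
    next
      case False
      have "(i', x) \<in> ?V'" if "(i', x) \<in> V" "col x = c" for i' x using that False ab by auto
      from slot_room_other_color[OF this V'V] show ?thesis using room by simp
    qed
  qed
qed

text \<open>Reserving \<open>a\<close> for row \<open>j\<close> leaves that slot with
  \<open>a\<close> alone and no rivals, which meets the room condition with equality. Every other
  slot of the color loses at most \<open>a\<close>, and \<open>j\<close> stops being its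
  rival.\<close>

lemma admissible_privatize:
  assumes A: "admissible \<sigma> \<eta> \<beta> V" and a: "(j, a) \<in> V"
  shows "admissible \<sigma> \<eta> \<beta> {(i, x) \<in> V. \<not> (i \<noteq> j \<and> x = a) \<and> \<not> (i = j \<and> x \<noteq> a \<and> col x = col a)}"
    (is "admissible _ _ _ ?V'")
proof (rule admissible_subset[OF A])
  note D = admissibleD[OF A]
  show V'V: "?V' \<subseteq> V" by auto
  fix i c assume i: "i \<in> {1..r}" and c: "c \<in> {1..k+1}" and row: "\<eta> `` {i} = \<sigma> `` {i}"
      and open_c: "c \<notin> col ` (\<eta> `` {i})"
  note room = D(11)[OF this]
  show "2 * card (slot_rivals col ?V' i c) + 1 \<le> card (slot col ?V' i c)"
  proof (cases "c = col a")
    case True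
    show ?thesis
    proof (cases "i = j")
      case True
      have "slot col ?V' j c = {a}" using a \<open>c = col a\<close> by (auto simp: slot_def)
      moreover from this have "slot_rivals col ?V' j c = {}" by (auto simp: slot_rivals_def slot_def)
      ultimately show ?thesis using True by simp
    next
      case False
      show ?thesis
      proof (rule slot_room[OF D(4) V'V False room])
        show "slot col V i c - {a, a} \<subseteq> slot col ?V' i c" using False by (auto simp: slot_def)
        show "a \<in> slot col V j c" "a \<in> slot col V j c" using a True by (auto simp: slot_def)
        show "slot col ?V' i c \<inter> slot col ?V' j c = {}" using True False by (auto simp: slot_def)
      qed
    qed
  next
    case False
    have "(i', x) \<in> ?V'" if "(i', x) \<in> V" "col x = c" for i' x using that False by auto
    from slot_room_other_color[OF this V'V] show ?thesis using room by simp
  qed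
qed

text \<open>If no row is open, then each row of \<open>\<sigma>\<close> has at least \<open>k\<close> elements, and unavoidability, applied
  to the full rows of \<open>\<eta>\<close> in an order that realizes \<open>\<beta>\<close>, bounds the number of abandoned rows.\<close>

lemma admissible_closed_card:
  assumes A: "admissible \<sigma> \<eta> \<beta> V"
    and closed: "\<And>i. i \<in> {1..r} \<Longrightarrow> \<eta> `` {i} = \<sigma> `` {i} \<Longrightarrow> {1..k+1} \<subseteq> col ` (\<eta> `` {i})"
  shows "int r * int k + s \<le> int (card \<sigma>)"
proof -
  note D = admissibleD[OF A]
  define M where "M = {i. \<eta> `` {i} \<noteq> \<sigma> `` {i}}"
  have MR: "M \<subseteq> {1..r}" using D(2,3) by (auto simp: M_def)
  have finM: "finite M" using MR by (rule finite_subset) simp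
  have \<beta>: "inj_on \<beta> M" using D(9) by (simp add: M_def)
  have \<beta>M: "\<beta> ` M \<subseteq> {1..r}" using D(10) unfolding M_def by blast
  note \<beta> = \<beta> \<beta>M
  have "card ({1..r} - M) = card ({1..r} - \<beta> ` M)"
    using card_Diff_subset[OF finM MR] card_Diff_subset[OF finite_imageI[OF finM] \<beta>(2)] card_image[OF \<beta>(1)]
    by simp
  \<comment> \<open>\<open>\<beta>\<close> is completed to a bijection \<open>g\<close> from rows to
    members of the family; the rows that are not abandoned receive the remaining members in any
    order.\<close>
  then obtain g0 where g0: "bij_betw g0 ({1..r} - M) ({1..r} - \<beta> ` M)"
    using finite_same_card_bij[of "{1..r} - M" "{1..r} - \<beta> ` M"] by auto
  define g where "g i = (if i \<in> M then \<beta> i else g0 i)" for i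
  have "bij_betw g M (\<beta> ` M)"
    using \<beta>(1) by (subst bij_betw_cong[of _ _ \<beta>]) (auto simp: g_def bij_betw_def)
  moreover have "bij_betw g ({1..r} - M) ({1..r} - \<beta> ` M)"
    using g0 by (subst bij_betw_cong[of _ _ g0]) (auto simp: g_def)
  ultimately have "bij_betw g (M \<union> ({1..r} - M)) (\<beta> ` M \<union> ({1..r} - \<beta> ` M))"
    by (rule bij_betw_combine) auto
  moreover have "M \<union> ({1..r} - M) = {1..r}" "\<beta> ` M \<union> ({1..r} - \<beta> ` M) = {1..r}"
    using MR \<beta>(2) by auto
  ultimately have g: "bij_betw g {1..r} {1..r}" by simp
  define h where "h = the_inv_into {1..r} g"
  have hR: "h j \<in> {1..r}" and gh: "g (h j) = j" if "j \<in> {1..r}" for j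
    using that g the_inv_into_into[of g "{1..r}" j "{1..r}"] f_the_inv_into_f[of g "{1..r}" j]
    by (auto simp: h_def bij_betw_def)
  \<comment> \<open>Member \<open>j\<close> is tested on the row of \<open>\<eta>\<close> assigned
    to it. On an abandoned row the test fails by the choice of \<open>\<beta>\<close>, so at most
    the other rows can pass.\<close>
  define X where "X j = \<eta> `` {h j}" for j
  have "s \<le> int (card {j \<in> {1..r}. X j \<in> K j})"
  proof (rule unavoidable_card)
    show "X j \<subseteq> {1..m}" for j using D(3) by (auto simp: X_def)
    show "inj_on col (X j)" for j using D(6) by (simp add: X_def)
    show "disjoint_family_on X {1..r}"
      unfolding disjoint_family_on_def X_def using D(5) gh by (metis (no_types, lifting) Image_singleton_iff disjoint_iff)
  qed
  also have "card {j \<in> {1..r}. X j \<in> K j} \<le> card ({1..r} - M)"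
  proof (rule card_inj_on_le[of h])
    show "inj_on h {j \<in> {1..r}. X j \<in> K j}" using gh by (auto intro: inj_on_inverseI[of _ g])
    show "h ` {j \<in> {1..r}. X j \<in> K j} \<subseteq> {1..r} - M"
    proof clarify
      fix j assume j: "j \<in> {1..r}" "X j \<in> K j"
      have "h j \<notin> M"
      proof
        assume hM: "h j \<in> M"
        then have "\<beta> (h j) = j" using gh[OF j(1)] by (simp add: g_def)
        then show False using D(10)[of "h j"] hM j(2) by (simp add: M_def X_def)
      qed
      then show "h j \<in> {1..r} - M" using hR[OF j(1)] by blast
    qed
  qed simp
  finally have s: "s \<le> int (card ({1..r} - M))" by simp
  have fin\<sigma>: "finite (\<sigma> `` {i})" for i using S_finite[OF D(1)] by (rule finite_Image)
  have "card (\<sigma> `` {i}) \<ge> k + (if i \<in> M then 0 else 1)" if i: "i \<in> {1..r}" for i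
  proof (cases "i \<in> M")
    case True
    then show ?thesis using D(10)[of i] by (simp add: M_def)
  next
    case False
    then have "{1..k+1} \<subseteq> col ` (\<sigma> `` {i})" using closed[OF i] by (simp add: M_def)
    from card_mono[OF finite_imageI[OF fin\<sigma>] this] card_image_le[OF fin\<sigma>, of col i]
    show ?thesis using False by simp
  qed
  then have "(\<Sum>i\<in>{1..r}. k + (if i \<in> M then 0 else 1)) \<le> (\<Sum>i\<in>{1..r}. card (\<sigma> `` {i}))"
    by (rule sum_mono)
  moreover have "(\<Sum>i\<in>{1..r}. card (\<sigma> `` {i})) = card \<sigma>"
  proof -
    have "\<sigma> = Sigma {1..r} (\<lambda>i. \<sigma> `` {i})" using D(2,3) by blast
    then show ?thesis using card_SigmaI[of "{1..r}" "\<lambda>i. \<sigma> `` {i}"] fin\<sigma> by simp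
  qed
  moreover have "(\<Sum>i\<in>{1..r}. k + (if i \<in> M then 0 else 1)) = r * k + card ({1..r} - M)"
  proof -
    have "(\<Sum>i\<in>{1..r}. if i \<in> M then 0 else 1::nat) = (\<Sum>i\<in>{1..r} - M. 1)"
      by (intro sum.mono_neutral_cong_right) auto
    then show ?thesis by (simp add: sum.distrib)
  qed
  ultimately have "r * k + card ({1..r} - M) \<le> card \<sigma>" by simp
  then have "int (r * k + card ({1..r} - M)) \<le> int (card \<sigma>)" by (rule of_nat_mono)
  then show ?thesis using s by simp
qed

section \<open>The induction on vertices\<close>

definition private_vertex :: "(nat \<times> nat) set \<Rightarrow> nat \<Rightarrow> nat \<Rightarrow> bool"
  where "private_vertex V j a \<longleftrightarrow> slot col V j (col a) = {a} \<and> (\<forall>i. i \<noteq> j \<longrightarrow> (i, a) \<notin> V)"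

lemma link_on_cone:
  assumes V: "finite V" and \<sigma>: "\<sigma> \<in> S"
    and "\<And>\<tau>. \<tau> \<subseteq> V \<Longrightarrow> \<tau> \<union> \<sigma> \<in> S \<Longrightarrow> insert w (\<tau> \<union> \<sigma>) \<in> S" and w: "w \<in> V"
  shows "cube_connected n (realization (link_on \<sigma> V))"
  using V
proof (rule cube_connected_cone[OF _ link_on_Pow])
  show "B \<in> link_on \<sigma> V" if "A \<in> link_on \<sigma> V" "B \<subseteq> A" for A B using that by (rule link_on_downward)
  show "insert w A \<in> link_on \<sigma> V" if "A \<in> link_on \<sigma> V" for A
    using that assms(3) w by (auto simp: link_on_def)
  show "{} \<in> link_on \<sigma> V" using \<sigma> by (simp add: link_on_def)
qed

text \<open>The alternatives \<open>(j, b)\<close> to \<open>a\<close> in row \<open>j\<close> (the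
  set \<open>D2\<close>) come back before the copies of \<open>a\<close> in other rows (the set
  \<open>D1\<close>). This order matters: the link of a copy of \<open>a\<close> removes the whole
  column \<open>a\<close>, so without its alternatives row \<open>j\<close> would be left with an
  empty slot. The price is paid in the links of \<open>(j, b)\<close>, where the other rows miss
  both \<open>a\<close> and \<open>b\<close>; hence the factor 2 in the room condition.\<close>

lemma cube_connected_privatize:
  assumes A: "admissible \<sigma> \<eta> \<beta> V" and a: "(j, a) \<in> V"
    and priv: "cube_connected n (realization (link_on \<sigma>
      {(i, x) \<in> V. \<not> (i \<noteq> j \<and> x = a) \<and> \<not> (i = j \<and> x \<noteq> a \<and> col x = col a)}))"
    and links: "\<And>\<sigma>' \<eta>' V' v. admissible \<sigma>' \<eta>' \<beta> V' \<Longrightarrow> \<sigma>' = insert v \<sigma> \<Longrightarrow> v \<in> V \<Longrightarrow> V' \<subset> V \<Longrightarrow>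
      cube_connected (n - 1) (realization (link_on \<sigma>' V'))"
  shows "cube_connected n (realization (link_on \<sigma> V))"
proof -
  note D = admissibleD[OF A]
  have finV: "finite V" using D(4) by (rule finite_subset) simp
  define D1 where "D1 = {(i, x) \<in> V. i \<noteq> j \<and> x = a}"
  define V1 where "V1 = V - D1"
  define D2 where "D2 = {(i, x) \<in> V. i = j \<and> x \<noteq> a \<and> col x = col a}"
  have V1V: "V1 \<subseteq> V" and D1V: "D1 \<subseteq> V" and D2V1: "D2 \<subseteq> V1" by (auto simp: V1_def D1_def D2_def)
  have V2: "V1 - D2 = {(i, x) \<in> V. \<not> (i \<noteq> j \<and> x = a) \<and> \<not> (i = j \<and> x \<noteq> a \<and> col x = col a)}"
    by (auto simp: V1_def D1_def D2_def)
  have "cube_connected n (realization (link_on \<sigma> V1))"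
  proof (rule cube_connected_add_vertices[OF finite_subset[OF V1V finV] D2V1])
    show "cube_connected n (realization (link_on \<sigma> (V1 - D2)))" using priv by (simp only: V2)
    fix v W assume v: "v \<in> D2" and W: "V1 - D2 \<subseteq> W" "W \<subseteq> V1 - {v}" and S: "insert v \<sigma> \<in> S"
    obtain b where b: "v = (j, b)" "(j, b) \<in> V" "b \<noteq> a" "col a = col b" using v by (auto simp: D2_def)
    define V' where "V' = {(i, x) \<in> V. x \<noteq> a \<and> x \<noteq> b \<and> \<not> (i = j \<and> col x = col b)}"
    have "admissible (insert v \<sigma>) (insert v \<eta>) \<beta> V'"
      unfolding V'_def b(1) by (rule admissible_link[OF A a b(2,4) S[unfolded b(1)]])
    moreover have "V' \<subset> V" using b(2) by (auto simp: V'_def)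
    ultimately have "cube_connected (n - 1) (realization (link_on (insert v \<sigma>) V'))"
      using links[OF _ refl] b(1,2) by blast
    moreover have "{\<tau>. \<tau> \<subseteq> W \<and> insert v (\<tau> \<union> \<sigma>) \<in> S} = link_on (insert v \<sigma>) V'"
      unfolding b(1)
    proof (rule link_on_insert_eq)
      have "V' \<subseteq> V1 - D2" using b(4) by (auto simp: V'_def V2)
      then show "V' \<subseteq> W" using W(1) by (rule order_trans)
      show "(j, b) \<notin> W" using W(2) b(1) by blast
      fix i x assume ix: "(i, x) \<in> W - V'"
      then have "(i, x) \<in> V1" using W(2) by blast
      then show "x = b \<or> i = j \<and> col x = col b"
        using ix b(4) by (auto simp: V'_def V1_def D1_def)
    qed
    ultimately show "cube_connected (n - 1) (realization {\<tau>. \<tau> \<subseteq> W \<and> insert v (\<tau> \<union> \<sigma>) \<in> S})"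
      by simp
  qed
  then show ?thesis
  proof (rule cube_connected_add_vertices[OF finV D1V, folded V1_def])
    fix v W assume v: "v \<in> D1" and W: "V1 \<subseteq> W" "W \<subseteq> V - {v}" and S: "insert v \<sigma> \<in> S"
    obtain i0 where b: "v = (i0, a)" "(i0, a) \<in> V" "i0 \<noteq> j" using v by (auto simp: D1_def)
    define V' where "V' = {(i, x) \<in> V. x \<noteq> a \<and> x \<noteq> a \<and> \<not> (i = i0 \<and> col x = col a)}"
    have "admissible (insert v \<sigma>) (insert v \<eta>) \<beta> V'"
      unfolding V'_def b(1) by (rule admissible_link[OF A b(2,2) refl S[unfolded b(1)]])
    moreover have "V' \<subset> V" using b(2) by (auto simp: V'_def)
    ultimately have "cube_connected (n - 1) (realization (link_on (insert v \<sigma>) V'))"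
      using links[OF _ refl] b(1,2) by blast
    moreover have "{\<tau>. \<tau> \<subseteq> W \<and> insert v (\<tau> \<union> \<sigma>) \<in> S} = link_on (insert v \<sigma>) V'"
      unfolding b(1)
    proof (rule link_on_insert_eq)
      have "V' \<subseteq> V1" by (auto simp: V'_def V1_def D1_def)
      then show "V' \<subseteq> W" using W(1) by (rule order_trans)
      show "(i0, a) \<notin> W" using W(2) b(1) by blast
      fix i x assume ix: "(i, x) \<in> W - V'"
      then have "(i, x) \<in> V" using W(2) by blast
      then show "x = a \<or> i = i0 \<and> col x = col a"
        using ix by (auto simp: V'_def)
    qed
    ultimately show "cube_connected (n - 1) (realization {\<tau>. \<tau> \<subseteq> W \<and> insert v (\<tau> \<union> \<sigma>) \<in> S})"
      by simp
  qed
qed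

text \<open>The link of a single vertex is always admissible again, by
  \<open>admissible_link\<close> with \<open>b = a\<close>; so only the deletion needs an argument
  of its own.\<close>

lemma cube_connected_delete_vertex:
  assumes A: "admissible \<sigma> \<eta> \<beta> V" and v: "(j, a) \<in> V"
    and del: "cube_connected n (realization (link_on \<sigma> (V - {(j, a)})))"
    and links: "\<And>\<sigma>' \<eta>' V' v. admissible \<sigma>' \<eta>' \<beta> V' \<Longrightarrow> \<sigma>' = insert v \<sigma> \<Longrightarrow> v \<in> V \<Longrightarrow> V' \<subset> V \<Longrightarrow>
      cube_connected (n - 1) (realization (link_on \<sigma>' V'))"
  shows "cube_connected n (realization (link_on \<sigma> V))"
proof (rule cube_connected_add_vertices[OF _ _ del])
  show "finite V" using admissibleD(4)[OF A] by (rule finite_subset) simp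
  show "{(j, a)} \<subseteq> V" using v by simp
  fix u W assume u: "u \<in> {(j, a)}" and W: "V - {(j, a)} \<subseteq> W" "W \<subseteq> V - {u}" and S: "insert u \<sigma> \<in> S"
  define V' where "V' = {(i, x) \<in> V. x \<noteq> a \<and> x \<noteq> a \<and> \<not> (i = j \<and> col x = col a)}"
  have u': "u = (j, a)" using u by simp
  have "admissible (insert u \<sigma>) (insert u \<eta>) \<beta> V'"
    unfolding V'_def u' by (rule admissible_link[OF A v v refl S[unfolded u']])
  moreover have "V' \<subset> V" using v by (auto simp: V'_def)
  ultimately have "cube_connected (n - 1) (realization (link_on (insert u \<sigma>) V'))"
    using links[OF _ refl] u' v by blast
  moreover have "{\<tau>. \<tau> \<subseteq> W \<and> insert u (\<tau> \<union> \<sigma>) \<in> S} = link_on (insert u \<sigma>) V'"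
    unfolding u'
  proof (rule link_on_insert_eq)
    have "V' \<subseteq> V - {(j, a)}" by (auto simp: V'_def)
    then show "V' \<subseteq> W" using W(1) by (rule order_trans)
    show "(j, a) \<notin> W" using W(2) u' by blast
    fix i x assume ix: "(i, x) \<in> W - V'"
    then have "(i, x) \<in> V" using W(2) by blast
    then show "x = a \<or> i = j \<and> col x = col a" using ix by (auto simp: V'_def)
  qed
  ultimately show "cube_connected (n - 1) (realization {\<tau>. \<tau> \<subseteq> W \<and> insert u (\<tau> \<union> \<sigma>) \<in> S})"
    by simp
qed

text \<open>Without a vertex of color \<open>c\<close>, row \<open>j\<close> never becomes full.\<close>

lemma insert_private_vertex:
  assumes A: "admissible \<sigma> \<eta> \<beta> V" and j: "(j, a) \<in> V" and pr: "private_vertex V j a"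
    and \<tau>: "\<tau> \<subseteq> V" "\<tau> \<union> \<sigma> \<in> S"
    and c: "c \<in> {1..k+1}" "c \<noteq> col a" "c \<notin> col ` ((\<tau> \<union> \<sigma>) `` {j})"
  shows "insert (j, a) (\<tau> \<union> \<sigma>) \<in> S"
proof (cases "(j, a) \<in> \<tau>")
  case True
  then have "insert (j, a) (\<tau> \<union> \<sigma>) = \<tau> \<union> \<sigma>" by blast
  then show ?thesis using \<tau>(2) by simp
next
  case False
  note D = admissibleD[OF A]
  have jR: "j \<in> {1..r}" and am: "a \<in> {1..m}" using D(4) j by auto
  let ?X = "(\<tau> \<union> \<sigma>) `` {j}"
  have X: "?X \<subseteq> {1..m}" using S_subset[OF \<tau>(2)] by blast
  have fresh: "(i, a) \<notin> \<tau> \<union> \<sigma>" for i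
    using D(2) D(7)[OF j] False \<tau>(1) pr by (cases "i = j") (auto simp: private_vertex_def)
  have ncol: "col a \<notin> col ` ?X"
  proof
    assume "col a \<in> col ` ?X"
    then obtain x where "x \<in> ?X" and cx: "col x = col a" by (metis imageE)
    then have x: "(j, x) \<in> \<tau> \<union> \<sigma>" "col x = col a" by (simp_all only: Image_singleton_iff)
    show False
    proof (cases "(j, x) \<in> \<tau>")
      case True
      then have "x \<in> slot col V j (col a)" using \<tau>(1) x(2) by (auto simp: slot_def)
      then show False using pr True False by (simp add: private_vertex_def)
    next
      case False
      then show False using D(8)[OF j, of x] D(2) x by auto
    qed
  qed
  have inj: "inj_on col (insert a ?X)"
    using S_row[OF \<tau>(2), of j] ncol by (auto simp: inj_on_insert)
  have "col ` (insert a ?X) \<subseteq> {1..k+1} - {c}"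
    using X am col(1) c by blast
  then have "card (col ` (insert a ?X)) \<le> card ({1..k+1} - {c})" by (intro card_mono) auto
  also have "\<dots> = k" using c(1) by simp
  finally have "card (insert a ?X) \<le> k" using card_image[OF inj] by simp
  then show ?thesis by (intro S_insert[OF \<tau>(2) jR am fresh inj])
qed

text \<open>If the last open color of a row cannot be filled in some simplex, then, exchanging the row with
  any of the abandoned rows, one finds more sets of the family that do not contain the full row
  than there are abandoned rows.\<close>

lemma abandon_row:
  assumes A: "admissible \<sigma> \<eta> \<beta> V" and v: "(j, a) \<in> V" and pr: "private_vertex V j a"
    and full: "{1..k+1} - {col a} \<subseteq> col ` (\<eta> `` {j})"
    and \<tau>: "\<tau> \<subseteq> V" "\<tau> \<union> \<sigma> \<in> S" "insert (j, a) (\<tau> \<union> \<sigma>) \<notin> S"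
  shows "\<exists>p. admissible \<sigma> (insert (j, a) \<eta>) (\<beta>(j := p)) (V - {(j, a)})"
proof -
  note D = admissibleD[OF A]
  have jR: "j \<in> {1..r}" and am: "a \<in> {1..m}" using D(4) v by auto
  define M where "M = {i. \<eta> `` {i} \<noteq> \<sigma> `` {i}}"
  have MR: "M \<subseteq> {1..r}" using D(2,3) by (auto simp: M_def)
  have finM: "finite M" using MR by (rule finite_subset) simp
  have jM: "j \<notin> M" using D(10)[of j] v by (auto simp: M_def)
  then have row: "\<eta> `` {j} = \<sigma> `` {j}" by (simp add: M_def)
  have ncol: "col a \<notin> col ` (\<eta> `` {j})" using D(8)[OF v] by blast
  \<comment> \<open>All other colors are used up in row \<open>j\<close> and \<open>a\<close> is
    alone in its color, so it is the only vertex left to this row.\<close>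
  have Vj: "V `` {j} = {a}"
  proof
    show "{a} \<subseteq> V `` {j}" using v by blast
    show "V `` {j} \<subseteq> {a}"
    proof
      fix x assume "x \<in> V `` {j}"
      then have x: "(j, x) \<in> V" by blast
      then have "col x \<in> {1..k+1}" using D(4) col(1) by blast
      moreover have "col x \<notin> col ` (\<eta> `` {j})" using D(8)[OF x] by blast
      ultimately have "x \<in> slot col V j (col a)" using full x by (auto simp: slot_def)
      then show "x \<in> {a}" using pr by (simp add: private_vertex_def)
    qed
  qed
  have \<sigma>j: "col ` (\<sigma> `` {j}) = {1..k+1} - {col a}"
  proof
    show "{1..k+1} - {col a} \<subseteq> col ` (\<sigma> `` {j})" using full row by simp
    show "col ` (\<sigma> `` {j}) \<subseteq> {1..k+1} - {col a}"
      using ncol S_subset[OF D(1)] col(1) unfolding row by blast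
  qed
  have card\<sigma>: "card (\<sigma> `` {j}) = k"
    using card_image[OF S_row[OF D(1), of j]] \<sigma>j col(1)[OF am] by simp
  define X where "X = insert a (\<sigma> `` {j})"
  obtain \<pi> where \<pi>: "\<pi> permutes {1..r}" "\<And>i. i \<in> {1..r} \<Longrightarrow> \<pi> i \<in> {1..r}"
    "\<And>i. i \<in> {1..r} \<Longrightarrow> (\<tau> \<union> \<sigma>) `` {i} \<in> K (\<pi> i)"
    using S_rows[OF \<tau>(2)] by blast
  have bad: "X \<notin> K (\<pi> i)" if i: "i \<in> insert j M" for i
  proof
    assume XK: "X \<in> K (\<pi> i)"
    \<comment> \<open>Swapping \<open>i\<close> and \<open>j\<close> hands \<open>X\<close> to
      \<open>K (\<pi> i)\<close> and the \<open>k\<close> elements of the abandoned row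
      \<open>i\<close>, which no vertex of \<open>V\<close> can enlarge, to
      \<open>K (\<pi> j)\<close>. For \<open>i = j\<close> the permutation is unchanged.\<close>
    define \<pi>' where "\<pi>' = \<pi> \<circ> Transposition.transpose i j"
    have iR: "i \<in> {1..r}" using i MR jR by blast
    have perm: "\<pi>' permutes {1..r}"
      unfolding \<pi>'_def by (intro permutes_compose[OF _ \<pi>(1)] permutes_swap_id iR jR)
    have "insert (j, a) (\<tau> \<union> \<sigma>) \<in> S"
    proof (rule S_intro[OF _ _ perm])
      show "insert (j, a) (\<tau> \<union> \<sigma>) \<subseteq> {1..r} \<times> {1..m}" using S_subset[OF \<tau>(2)] jR am by blast
      have fresh: "i' = j" if "(i', a) \<in> \<tau> \<union> \<sigma>" for i'
        using that pr \<tau>(1) D(2) D(7)[OF v] unfolding private_vertex_def by blast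
      show "i1 = i2" if "(i1, x) \<in> insert (j, a) (\<tau> \<union> \<sigma>)" "(i2, x) \<in> insert (j, a) (\<tau> \<union> \<sigma>)" for i1 i2 x
        using that S_column[OF \<tau>(2)] fresh by blast
      fix i' assume i': "i' \<in> {1..r}"
      consider "i' = j" | "i' \<noteq> j" "i' = i" | "i' \<noteq> j" "i' \<noteq> i" by blast
      then show "insert (j, a) (\<tau> \<union> \<sigma>) `` {i'} \<in> K (\<pi>' i')"
      proof cases
        case 1
        have "insert (j, a) (\<tau> \<union> \<sigma>) `` {j} = X" using \<tau>(1) Vj unfolding X_def by blast
        moreover have "\<pi>' j = \<pi> i" by (simp add: \<pi>'_def)
        ultimately show ?thesis using XK 1 by simp
      next
        case 2
        then have iM: "i \<in> M" using i by blast
        then have "V `` {i} = {}" "card (\<sigma> `` {i}) = k" using D(10)[of i] by (auto simp: M_def)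
        then have eq: "insert (j, a) (\<tau> \<union> \<sigma>) `` {i'} = \<sigma> `` {i}" using 2 \<tau>(1) by blast
        have "\<pi>' i' = \<pi> j" using 2 by (simp add: \<pi>'_def)
        moreover have "\<sigma> `` {i} \<in> K (\<pi> j)"
          using S_subset[OF D(1)] S_row[OF D(1)] \<open>card (\<sigma> `` {i}) = k\<close>
          by (intro K_small \<pi>(2) jR) auto
        ultimately show ?thesis using eq by simp
      next
        case 3
        then have "insert (j, a) (\<tau> \<union> \<sigma>) `` {i'} = (\<tau> \<union> \<sigma>) `` {i'}" by auto
        moreover have "\<pi>' i' = \<pi> i'" using 3 by (simp add: \<pi>'_def transpose_def)
        ultimately show ?thesis using \<pi>(3)[OF i'] by simp
      qed
    qed
    then show False using \<tau>(3) by blast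
  qed
  have "card (\<beta> ` M) \<le> card M" using finM by (rule card_image_le)
  also have "card M < card (insert j M)" using finM jM by simp
  also have "\<dots> = card (\<pi> ` insert j M)"
    by (rule card_image[symmetric], rule inj_on_subset[OF permutes_inj[OF \<pi>(1)]]) simp
  finally have "\<not> \<pi> ` insert j M \<subseteq> \<beta> ` M"
    using card_mono[OF finite_imageI[OF finM], of "\<pi> ` insert j M" \<beta>] by linarith
  then obtain i0 where i0: "i0 \<in> insert j M" "\<pi> i0 \<notin> \<beta> ` M" by blast
  define p where "p = \<pi> i0"
  have pR: "p \<in> {1..r}" using i0(1) MR jR \<pi>(2) unfolding p_def by blast
  have pX: "X \<notin> K p" using bad[OF i0(1)] by (simp add: p_def)
  have pM: "p \<notin> \<beta> ` M" using i0(2) by (simp add: p_def)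
  have \<eta>': "insert (j, a) \<eta> `` {i} = (if i = j then X else \<eta> `` {i})" for i
    by (simp add: row_insert X_def row)
  have aX: "X \<noteq> \<sigma> `` {j}" using D(2) D(7)[OF v] by (auto simp: X_def)
  have M': "{i. insert (j, a) \<eta> `` {i} \<noteq> \<sigma> `` {i}} = insert j M"
    unfolding \<eta>' using aX by (auto simp: M_def)
  have "admissible \<sigma> (insert (j, a) \<eta>) (\<beta>(j := p)) (V - {(j, a)})"
  proof (rule admissibleI[OF D(1)])
    show "\<sigma> \<subseteq> insert (j, a) \<eta>" "insert (j, a) \<eta> \<subseteq> {1..r} \<times> {1..m}" "V - {(j, a)} \<subseteq> {1..r} \<times> {1..m}"
      using D(2,3,4) jR am by auto
    show "i = i'" if "(i, x) \<in> insert (j, a) \<eta>" "(i', x) \<in> insert (j, a) \<eta>" for i i' x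
      using that D(5) D(7)[OF v] by blast
    show "inj_on col (insert (j, a) \<eta> `` {i})" for i
      using D(6)[of i] D(8)[OF v] by (auto simp: row_insert inj_on_insert)
    show "(i', x) \<notin> insert (j, a) \<eta>" if "(i, x) \<in> V - {(j, a)}" for i i' x
      using that D(7) pr unfolding private_vertex_def by blast
    show "col x \<noteq> col y" if "(i, x) \<in> V - {(j, a)}" "(i, y) \<in> insert (j, a) \<eta>" for i x y
      using that D(8) Vj by blast
    show "inj_on (\<beta>(j := p)) {i. insert (j, a) \<eta> `` {i} \<noteq> \<sigma> `` {i}}"
    proof -
      have "inj_on (\<beta>(j := p)) M" using D(9) jM by (auto simp: M_def inj_on_def)
      moreover have "(\<beta>(j := p)) ` M = \<beta> ` M" using jM by (intro image_cong) auto
      ultimately show ?thesis unfolding M' using pM jM by (simp add: inj_on_insert)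
    qed
  next
    fix i assume "insert (j, a) \<eta> `` {i} \<noteq> \<sigma> `` {i}"
    then have i: "i \<in> insert j M" using M' by blast
    show "(\<beta>(j := p)) i \<in> {1..r} \<and> insert (j, a) \<eta> `` {i} \<notin> K ((\<beta>(j := p)) i) \<and>
      card (\<sigma> `` {i}) = k \<and> (V - {(j, a)}) `` {i} = {}"
    proof (cases "i = j")
      case True
      have "(V - {(j, a)}) `` {j} = {}" using Vj by blast
      then show ?thesis using True pR pX card\<sigma> by (simp add: \<eta>')
    next
      case False
      then have "i \<in> M" using i by blast
      then have *: "\<beta> i \<in> {1..r} \<and> \<eta> `` {i} \<notin> K (\<beta> i) \<and> card (\<sigma> `` {i}) = k \<and> V `` {i} = {}"
        using D(10)[of i] by (simp add: M_def)
      then have "(V - {(j, a)}) `` {i} = {}" by blast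
      then show ?thesis using False * by (simp add: \<eta>')
    qed
  next
    fix i c assume i: "i \<in> {1..r}" and c: "c \<in> {1..k+1}" and "insert (j, a) \<eta> `` {i} = \<sigma> `` {i}"
      and nc: "c \<notin> col ` (insert (j, a) \<eta> `` {i})"
    then have iM: "i \<noteq> j" "i \<notin> M" using M' by blast+
    have "c \<notin> col ` (\<eta> `` {i})" using nc by blast
    from D(11)[OF i c _ this] have room: "2 * card (slot_rivals col V i c) + 1 \<le> card (slot col V i c)"
      using iM(2) by (simp add: M_def)
    have slot: "slot col (V - {(j, a)}) i c = slot col V i c" using iM(1) by (auto simp: slot_def)
    have "slot col (V - {(j, a)}) i' c \<subseteq> slot col V i' c" for i' by (auto simp: slot_def)
    then have "slot_rivals col (V - {(j, a)}) i c \<subseteq> slot_rivals col V i c"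
      unfolding slot_rivals_def slot by blast
    then have "card (slot_rivals col (V - {(j, a)}) i c) \<le> card (slot_rivals col V i c)"
      by (rule card_mono[OF finite_slot_rivals(2)[OF D(4)]])
    then show "2 * card (slot_rivals col (V - {(j, a)}) i c) + 1 \<le> card (slot col (V - {(j, a)}) i c)"
      using room unfolding slot by linarith
  qed
  then show ?thesis by blast
qed

text \<open>Reserving a vertex, abandoning a row and passing to a link all shrink \<open>V\<close>;
  since \<open>\<eta>\<close> and \<open>\<beta>\<close> occur only in the hypothesis, they may
  change along the way. When no row is open, \<open>admissible_closed_card\<close> brings the bound
  down to -2 or less, where nothing is claimed.\<close>

theorem cube_connected_admissible:
  assumes "admissible \<sigma> \<eta> \<beta> V"
  shows "cube_connected (int r * int k + s - 2 - int (card \<sigma>)) (realization (link_on \<sigma> V))"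
  using assms
proof (induction "card V" arbitrary: \<sigma> \<eta> \<beta> V rule: less_induct)
  case less
  note A = less.prems
  note D = admissibleD[OF A]
  define n where "n = int r * int k + s - 2 - int (card \<sigma>)"
  have finV: "finite V" using D(4) by (rule finite_subset) simp
  have smaller: "cube_connected n (realization (link_on \<sigma> V'))"
    if "admissible \<sigma> \<eta>' \<beta>' V'" "V' \<subset> V" for \<eta>' \<beta>' V'
    unfolding n_def using less.hyps[OF psubset_card_mono[OF finV that(2)] that(1)] .
  have links: "cube_connected (n - 1) (realization (link_on \<sigma>' V'))"
    if "admissible \<sigma>' \<eta>' \<beta> V'" "\<sigma>' = insert v \<sigma>" "v \<in> V" "V' \<subset> V" for \<sigma>' \<eta>' V' v
  proof -
    \<comment> \<open>The vertex must be new, so that the bound falls by exactly one.\<close>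
    have "v \<notin> \<sigma>"
    proof
      assume "v \<in> \<sigma>"
      then have "(fst v, snd v) \<in> \<eta>" using D(2) by auto
      moreover have "(fst v, snd v) \<in> V" using that(3) by simp
      from D(7)[OF this] have "(fst v, snd v) \<notin> \<eta>" .
      ultimately show False by contradiction
    qed
    then have "int (card \<sigma>') = int (card \<sigma>) + 1" using S_finite[OF D(1)] that(2) by simp
    moreover have "cube_connected (int r * int k + s - 2 - int (card \<sigma>')) (realization (link_on \<sigma>' V'))"
      by (rule less.hyps[OF psubset_card_mono[OF finV that(4)] that(1)])
    ultimately show ?thesis by (simp add: n_def algebra_simps)
  qed
  have "cube_connected n (realization (link_on \<sigma> V))"
  proof (cases "\<exists>j a. (j, a) \<in> V \<and> \<not> private_vertex V j a")
    case True
    then obtain j a where a: "(j, a) \<in> V" "\<not> private_vertex V j a" by blast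
    define V' where "V' = {(i, x) \<in> V. \<not> (i \<noteq> j \<and> x = a) \<and> \<not> (i = j \<and> x \<noteq> a \<and> col x = col a)}"
    have "V' \<noteq> V"
    proof
      assume eq: "V' = V"
      have kept: "\<not> (i \<noteq> j \<and> x = a) \<and> \<not> (i = j \<and> x \<noteq> a \<and> col x = col a)" if "(i, x) \<in> V" for i x
      proof -
        have "(i, x) \<in> V'" using that eq by simp
        then show ?thesis by (simp add: V'_def)
      qed
      have "slot col V j (col a) = {a}" using a(1) kept by (auto simp: slot_def)
      moreover have "(i, a) \<notin> V" if "i \<noteq> j" for i using that kept by blast
      ultimately show False using a(2) by (simp add: private_vertex_def)
    qed
    then have "V' \<subset> V" by (auto simp: V'_def)
    then have "cube_connected n (realization (link_on \<sigma> V'))"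
      using smaller admissible_privatize[OF A a(1)] by (simp add: V'_def)
    then show ?thesis
      unfolding V'_def by (rule cube_connected_privatize[OF A a(1) _ links])
  next
    case False
    then have pr: "private_vertex V j a" if "(j, a) \<in> V" for j a using that by blast
    have vertex: "\<exists>a. (j, a) \<in> V \<and> col a = c"
      if "j \<in> {1..r}" "c \<in> {1..k+1}" "\<eta> `` {j} = \<sigma> `` {j}" "c \<notin> col ` (\<eta> `` {j})" for j c
    proof -
      have "slot col V j c \<noteq> {}" using D(11)[OF that] by auto
      then show ?thesis by (auto simp: slot_def)
    qed
    show ?thesis
    proof (cases "\<exists>j\<in>{1..r}. \<eta> `` {j} = \<sigma> `` {j} \<and> \<not> {1..k+1} \<subseteq> col ` (\<eta> `` {j})")
      case False
      then have "int r * int k + s \<le> int (card \<sigma>)"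
        by (intro admissible_closed_card[OF A]) blast
      then show ?thesis by (intro cube_connected_trivial) (simp add: n_def)
    next
      case True
      then obtain j c where j: "j \<in> {1..r}" "\<eta> `` {j} = \<sigma> `` {j}" and c: "c \<in> {1..k+1}" "c \<notin> col ` (\<eta> `` {j})"
        by blast
      obtain a where a: "(j, a) \<in> V" "col a = c" using vertex[OF j(1) c(1) j(2) c(2)] by blast
      show ?thesis
      proof (cases "{1..k+1} - {col a} \<subseteq> col ` (\<eta> `` {j})")
        case False
        then obtain c' where c': "c' \<in> {1..k+1}" "c' \<noteq> c" "c' \<notin> col ` (\<eta> `` {j})" using a(2) by blast
        obtain b where b: "(j, b) \<in> V" "col b = c'" using vertex[OF j(1) c'(1) j(2) c'(3)] by blast
        \<comment> \<open>Once \<open>(j, a)\<close>, the only vertex of color \<open>c\<close> in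
          row \<open>j\<close>, is gone, this row never becomes full; so \<open>(j, b)\<close> can
          join every simplex and is a cone point.\<close>
        have "cube_connected n (realization (link_on \<sigma> (V - {(j, a)})))"
        proof (rule link_on_cone[OF _ D(1), where w = "(j, b)"])
          show "finite (V - {(j, a)})" using finV by simp
          show "(j, b) \<in> V - {(j, a)}" using a(2) b c'(2) by auto
          fix \<tau> assume \<tau>: "\<tau> \<subseteq> V - {(j, a)}" "\<tau> \<union> \<sigma> \<in> S"
          have "c \<notin> col ` ((\<tau> \<union> \<sigma>) `` {j})"
          proof
            assume "c \<in> col ` ((\<tau> \<union> \<sigma>) `` {j})"
            then obtain x where x: "(j, x) \<in> \<tau> \<union> \<sigma>" "col x = c" by auto
            have "(j, x) \<notin> \<sigma>" using c(2) j(2) x(2) by blast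
            then have "x \<in> slot col V j (col a)" "x \<noteq> a" using x \<tau>(1) a(2) by (auto simp: slot_def)
            then show False using pr[OF a(1)] by (simp add: private_vertex_def)
          qed
          moreover have "\<tau> \<subseteq> V" using \<tau>(1) by blast
          ultimately show "insert (j, b) (\<tau> \<union> \<sigma>) \<in> S"
            using insert_private_vertex[OF A b(1) pr[OF b(1)] _ \<tau>(2) c(1)] b(2) c'(2) by blast
        qed
        then show ?thesis by (rule cube_connected_delete_vertex[OF A a(1) _ links])
      next
        case True
        show ?thesis
        proof (cases "\<forall>\<tau>. \<tau> \<subseteq> V \<longrightarrow> \<tau> \<union> \<sigma> \<in> S \<longrightarrow> insert (j, a) (\<tau> \<union> \<sigma>) \<in> S")
          case cone: True
          show ?thesis by (rule link_on_cone[OF finV D(1) _ a(1)]) (use cone in blast)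
        next
          case False
          then obtain \<tau> where \<tau>: "\<tau> \<subseteq> V" "\<tau> \<union> \<sigma> \<in> S" "insert (j, a) (\<tau> \<union> \<sigma>) \<notin> S" by blast
          obtain p where "admissible \<sigma> (insert (j, a) \<eta>) (\<beta>(j := p)) (V - {(j, a)})"
            using abandon_row[OF A a(1) pr[OF a(1)] True \<tau>] by blast
          moreover have "V - {(j, a)} \<subset> V" using a(1) by blast
          ultimately have "cube_connected n (realization (link_on \<sigma> (V - {(j, a)})))" by (rule smaller)
          then show ?thesis by (rule cube_connected_delete_vertex[OF A a(1) _ links])
        qed
      qed
    qed
  qed
  then show ?case by (simp add: n_def)
qed

text \<open>At the start each slot of color \<open>c\<close> is all of \<open>C c\<close>, with
  \<open>2r - 1 = 2 (r - 1) + 1\<close> elements, and there are at most \<open>r - 1\<close>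
  rivals.\<close>

lemma admissible_empty:
  assumes m: "\<And>i. i \<in> {1..k+1} \<Longrightarrow> card (C i) = 2 * r - 1"
  shows "admissible {} {} \<beta> ({1..r} \<times> {1..m})"
proof (rule admissibleI)
  have "{} \<in> K i" if "i \<in> {1..r}" for i
    using subcomplex[OF that] by (simp add: subcomplex_of_simplex_def)
  then show "{} \<in> S" by (intro S_intro[OF _ _ permutes_id]) auto
next
  fix i c assume i: "i \<in> {1..r}" and c: "c \<in> {1..k+1}"
  have "slot col ({1..r} \<times> {1..m}) i c = C c"
    using i col(2) col_eq[OF c] C_subset[OF c] by (auto simp: slot_def)
  moreover have "slot_rivals col ({1..r} \<times> {1..m}) i c \<subseteq> {1..r} - {i}"
    by (auto simp: slot_rivals_def slot_def)
  then have "card (slot_rivals col ({1..r} \<times> {1..m}) i c) \<le> card ({1..r} - {i})"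
    by (intro card_mono) auto
  then have "card (slot_rivals col ({1..r} \<times> {1..m}) i c) \<le> r - 1" using i by simp
  moreover have "2 * r - 1 = 2 * (r - 1) + 1" using i by auto
  ultimately show "2 * card (slot_rivals col ({1..r} \<times> {1..m}) i c) + 1 \<le> card (slot col ({1..r} \<times> {1..m}) i c)"
    using m[OF c] i by simp
qed auto

end

theorem mainTheorem2:
  fixes r k m :: nat and s :: int
    and C :: "nat \<Rightarrow> nat set" and K :: "nat \<Rightarrow> nat set set"
  assumes "r \<ge> 1"
    and "m = (2 * r - 1) * (k + 1)"
    and "coloring m k C"
    and "\<And>i. i \<in> {1..k+1} \<Longrightarrow> card (C i) = 2 * r - 1"
    and "\<And>i. i \<in> {1..r} \<Longrightarrow> subcomplex_of_simplex m (K i)"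
    and "collectively_rainbow_unavoidable m k C r s K"
    and "\<And>i. i \<in> {1..r} \<Longrightarrow> rainbow_balanced m k C (K i)"
  shows "n_connected_space (int r * int k + s - 2)
           (geometric_realization (symm_deleted_join r K))"
proof -
  interpret rainbow_family r k m s C K
    using assms by unfold_locales auto
  \<comment> \<open>The induction is started at the empty simplex with all vertices present, where
    the restricted link is the whole complex and no row is abandoned.\<close>
  have "cube_connected (int r * int k + s - 2) (realization (link_on {} ({1..r} \<times> {1..m})))"
    using cube_connected_admissible[OF admissible_empty[OF assms(4)]] by simp
  moreover have "link_on {} ({1..r} \<times> {1..m}) = symm_deleted_join r K"
    using S_subset by (auto simp: link_on_def)
  ultimately show ?thesis
    unfolding geometric_realization_eq by (intro n_connected_space_cube_connected) simp
qed

end
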